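(* Let $G,F,Q,\omega$ and the quasi-bialgebra $(A^{\mathrm{op}},\Phi)$ be as described in the context. There is a quasi-Hopf algebra structure on $A^{\mathrm{op}}$, with quasi-antipode $\mathcal S:A^{\mathrm{op}}\to A^{\mathrm{op}}$ given, for $p\in Q$, $x\in F$, by $$\mathcal S(\delta_px)=\tau_{p\succ x}(p,p^R)^{-1}\,\sigma_{p^R}\bigl(p\succ x,(p\succ x)^{-1}\bigr)^{-1}\,\delta_{(p\triangleleft x)^R}\,(p\succ x)^{-1},$$ with $\alpha=1$ and $$\beta=\sum_{q\in Q}\omega(q^{-1},q,q^{-1})\,\delta_q\,\theta(q^L,q)^{-1}=\sum_{q\in Q}\omega(q,q^{-1},q)^{-1}\,\delta_q\,\theta(q^L,q)^{-1}.$$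
   Context: Setting. $k$ is an algebraically closed field of characteristic zero; $G$ is a finite group with identity $e$; $F\subseteq G$ is a subgroup; $Q\subseteq G$ with $e\in Q$ is simultaneously a set of representatives of the cosets $Fg$ and of the cosets $gF$, so every $g\in G$ factors uniquely as $g=xq$ and uniquely as $g=py$ with $x,y\in F$, $p,q\in Q$. Define $\triangleright:Q\times F\to F$, $\triangleleft:Q\times F\to Q$, $.:Q\times Q\to Q$, $\theta:Q\times Q\to F$ by $qx=(q\triangleright x)(q\triangleleft x)$ and $pq=\theta(p,q)\,(p.q)$ for $p,q\in Q$, $x\in F$. For every $p\in Q$ there are unique $p^L,p^R\in Q$ with $p^L.p=e=p.p^R$. Define $\succ:Q\times F\to F$ by $p\succ x=\theta(p,p^R)^{-1}\,(p\triangleright x)\,\theta(p\triangleleft x,(p\triangleleft x)^R)$. Inverses $q^{-1}$ and $(p\succ x)^{-1}$ are taken in $G$. $\omega:G\times G\times G\to k^\times$ is a normalized 3-cocycle, i.e. $\omega(ab,c,d)\omega(a,b,cd)=\omega(a,b,c)\omega(a,bc,d)\omega(b,c,d)$ and $\omega(e,a,b)=\omega(a,e,b)=\omega(a,b,e)=1$, satisfying $\omega|_{F\times G\times G}=1$ and $\omega|_{G\times F\times Q}=1$. Put $\sigma_p(x,y)=\omega(p,x,y)$ and $\tau_x(p,q)=\omega(p,q,x)$ for $p,q\in Q$, $x,y\in F$. $A=k^Q\#_\sigma kF$ is the vector space $k^Q\otimes kF$ with basis $\delta_px:=\delta_p\otimes x$ ($p\in Q$, $x\in F$), multiplication $(\delta_px).(\delta_qy)=\delta_{p\triangleleft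 x,\,q}\,\sigma_p(x,y)\,\delta_p\,xy$ (first $\delta$ a Kronecker delta), unit $\sum_{p\in Q}\delta_pe$, comultiplication $\Delta(\delta_px)=\sum_{s.t=p}\tau_x(s,t)\,\delta_s(t\triangleright x)\otimes\delta_tx$ and counit $\epsilon(\delta_px)=\delta_{p,e}$. $A^{\mathrm{op}}$ is $A$ with the opposite multiplication $a\circ b=b.a$ and the same $\Delta,\epsilon$; it is a quasi-bialgebra with associator $\Phi=\sum_{p,q,r\in Q}\omega(p,q,r)\,\delta_p\theta(q,r)\otimes\delta_qe\otimes\delta_re$. Quasi-bialgebra $(H,\Delta,\epsilon,\Phi)$: $\Delta,\epsilon$ are algebra maps, $\Phi\in H^{\otimes3}$ is invertible, $(\mathrm{id}\otimes\mathrm{id}\otimes\Delta)(\Phi)(\Delta\otimes\mathrm{id}\otimes\mathrm{id})(\Phi)=(1\otimes\Phi)(\mathrm{id}\otimes\Delta\otimes\mathrm{id})(\Phi)(\Phi\otimes1)$, $(\mathrm{id}\otimes\epsilon\otimes\mathrm{id})(\Phi)=1\otimes1$, $(\epsilon\otimes\mathrm{id})\Delta(h)=h=(\mathrm{id}\otimes\epsilon)\Delta(h)$, $\Phi(\Delta\otimes\mathrm{id})\Delta(h)\Phi^{-1}=(\mathrm{id}\otimes\Delta)\Delta(h)$. A quasi-Hopf structure on it consists of an algebra anti-automorphism $\mathcal S$ of $H$ (the quasi-antipode) and elements $\alpha,\beta\in H$ such that for all $h\in H$: $\mathcal S(h_1)\alpha h_2=\epsilon(h)\alpha$, $h_1\beta\mathcal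 S(h_2)=\epsilon(h)\beta$ (with $\Delta(h)=h_1\otimes h_2$), and $\Phi^{(1)}\beta\mathcal S(\Phi^{(2)})\alpha\Phi^{(3)}=1=\mathcal S(\Phi^{(-1)})\alpha\Phi^{(-2)}\beta\mathcal S(\Phi^{(-3)})$, where $\Phi=\Phi^{(1)}\otimes\Phi^{(2)}\otimes\Phi^{(3)}$ and $\Phi^{-1}=\Phi^{(-1)}\otimes\Phi^{(-2)}\otimes\Phi^{(-3)}$. For $H=A^{\mathrm{op}}$ all products are taken with respect to $\circ$. *)

theory Defs
  imports "HOL-Algebra.Coset" "HOL-Computational_Algebra.Polynomial"
begin

section \<open>Finite-dimensional vector spaces with a chosen basis, and their tensor products\<close>

text \<open>A vector space with finite basis \<open>I\<close> is the space of functions vanishing off \<open>I\<close>.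
  The tensor product of the spaces on \<open>I\<close> and \<open>J\<close> is the space on \<open>I \<times> J\<close>.
  Iterated tensor products are nested to the right, as in the product type
  \<open>'b \<times> 'b \<times> 'b\<close>.\<close>

definition vec_on :: "'b set \<Rightarrow> ('b \<Rightarrow> 'k::field) set" where
  "vec_on I = {v. \<forall>b. b \<notin> I \<longrightarrow> v b = 0}"

definition bv :: "'b \<Rightarrow> 'b \<Rightarrow> 'k::field" where
  "bv b = (\<lambda>c. if c = b then 1 else 0)"

definition vadd :: "('b \<Rightarrow> 'k::field) \<Rightarrow> ('b \<Rightarrow> 'k) \<Rightarrow> 'b \<Rightarrow> 'k" where
  "vadd v w = (\<lambda>b. v b + w b)"

definition scale :: "'k::field \<Rightarrow> ('b \<Rightarrow> 'k) \<Rightarrow> 'b \<Rightarrow> 'k" where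
  "scale c v = (\<lambda>b. c * v b)"

definition linear_map_on :: "'b set \<Rightarrow> 'c set \<Rightarrow> (('b \<Rightarrow> 'k::field) \<Rightarrow> 'c \<Rightarrow> 'k) \<Rightarrow> bool" where
  "linear_map_on I J f \<longleftrightarrow>
     (\<forall>v\<in>vec_on I. f v \<in> vec_on J) \<and>
     (\<forall>v\<in>vec_on I. \<forall>w\<in>vec_on I. f (vadd v w) = vadd (f v) (f w)) \<and>
     (\<forall>c. \<forall>v\<in>vec_on I. f (scale c v) = scale c (f v))"

definition linear_form_on :: "'b set \<Rightarrow> (('b \<Rightarrow> 'k::field) \<Rightarrow> 'k) \<Rightarrow> bool" where
  "linear_form_on I f \<longleftrightarrow>
     (\<forall>v\<in>vec_on I. \<forall>w\<in>vec_on I. f (vadd v w) = f v + f w) \<and>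
     (\<forall>c. \<forall>v\<in>vec_on I. f (scale c v) = c * f v)"

definition tensor :: "('b \<Rightarrow> 'k::field) \<Rightarrow> ('c \<Rightarrow> 'k) \<Rightarrow> 'b \<times> 'c \<Rightarrow> 'k" where
  "tensor v w = (\<lambda>(b, c). v b * w c)"

text \<open>\<open>tensor_map I J f g\<close> is \<open>f \<otimes> g\<close> on the space with basis \<open>I \<times> J\<close>.\<close>

definition tensor_map :: "'b set \<Rightarrow> 'c set \<Rightarrow> (('b \<Rightarrow> 'k::field) \<Rightarrow> 'd \<Rightarrow> 'k) \<Rightarrow>
    (('c \<Rightarrow> 'k) \<Rightarrow> 'e \<Rightarrow> 'k) \<Rightarrow> ('b \<times> 'c \<Rightarrow> 'k) \<Rightarrow> 'd \<times> 'e \<Rightarrow> 'k" where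
  "tensor_map I J f g w =
     (\<lambda>d. \<Sum>(i, j)\<in>I \<times> J. w (i, j) * tensor (f (bv i)) (g (bv j)) d)"

definition reassoc :: "(('b \<times> 'c) \<times> 'd \<Rightarrow> 'k) \<Rightarrow> 'b \<times> 'c \<times> 'd \<Rightarrow> 'k" where
  "reassoc w = (\<lambda>(b, c, d). w ((b, c), d))"

section \<open>Quasi-Hopf algebras\<close>

record ('b, 'k) based_alg = "('b \<Rightarrow> 'k) monoid" +
  ixs :: "'b set"

locale based_algebra = monoid H for H :: "('b, 'k::field) based_alg" (structure) +
  assumes finite_ixs: "finite (ixs H)"
    and carrier_eq: "carrier H = vec_on (ixs H)"
    and mult_linear_left: "\<And>w. w \<in> carrier H \<Longrightarrow> linear_map_on (ixs H) (ixs H) (\<lambda>v. v \<otimes> w)"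
    and mult_linear_right: "\<And>v. v \<in> carrier H \<Longrightarrow> linear_map_on (ixs H) (ixs H) (\<lambda>w. v \<otimes> w)"

definition tensor_alg ::
  "('b, 'k::field) based_alg \<Rightarrow> ('c, 'k) based_alg \<Rightarrow> ('b \<times> 'c, 'k) based_alg" where
  "tensor_alg A B =
     \<lparr> carrier = vec_on (ixs A \<times> ixs B),
       monoid.mult = (\<lambda>v w d. \<Sum>(a, b)\<in>ixs A \<times> ixs B. \<Sum>(a', b')\<in>ixs A \<times> ixs B.
          v (a, b) * w (a', b') * tensor (bv a \<otimes>\<^bsub>A\<^esub> bv a') (bv b \<otimes>\<^bsub>B\<^esub> bv b') d),
       one = tensor \<one>\<^bsub>A\<^esub> \<one>\<^bsub>B\<^esub>,
       ixs = ixs A \<times> ixs B \<rparr>"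

definition opposite_alg :: "('b, 'k) based_alg \<Rightarrow> ('b, 'k) based_alg" where
  "opposite_alg A = A\<lparr>monoid.mult := (\<lambda>a b. b \<otimes>\<^bsub>A\<^esub> a)\<rparr>"

abbreviation tensor_sq :: "('b, 'k::field) based_alg \<Rightarrow> ('b \<times> 'b, 'k) based_alg" where
  "tensor_sq H \<equiv> tensor_alg H H"

abbreviation tensor_cube :: "('b, 'k::field) based_alg \<Rightarrow> ('b \<times> 'b \<times> 'b, 'k) based_alg" where
  "tensor_cube H \<equiv> tensor_alg H (tensor_sq H)"

abbreviation tensor_fourth ::
  "('b, 'k::field) based_alg \<Rightarrow> ('b \<times> 'b \<times> 'b \<times> 'b, 'k) based_alg" where
  "tensor_fourth H \<equiv> tensor_alg H (tensor_cube H)"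

locale quasi_bialgebra = based_algebra H
  for H :: "('b, 'k::field) based_alg" (structure) +
  fixes \<Delta> :: "('b \<Rightarrow> 'k) \<Rightarrow> 'b \<times> 'b \<Rightarrow> 'k"
    and \<epsilon> :: "('b \<Rightarrow> 'k) \<Rightarrow> 'k"
    and \<Phi> :: "'b \<times> 'b \<times> 'b \<Rightarrow> 'k"
  assumes comult_linear: "linear_map_on (ixs H) (ixs H \<times> ixs H) \<Delta>"
    and comult_mult: "\<And>a b. a \<in> carrier H \<Longrightarrow> b \<in> carrier H \<Longrightarrow>
          \<Delta> (a \<otimes> b) = \<Delta> a \<otimes>\<^bsub>tensor_sq H\<^esub> \<Delta> b"
    and comult_one: "\<Delta> \<one> = \<one>\<^bsub>tensor_sq H\<^esub>"
    and counit_linear: "linear_form_on (ixs H) \<epsilon>"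
    and counit_mult: "\<And>a b. a \<in> carrier H \<Longrightarrow> b \<in> carrier H \<Longrightarrow> \<epsilon> (a \<otimes> b) = \<epsilon> a * \<epsilon> b"
    and counit_one: "\<epsilon> \<one> = 1"
    and assoc_Units: "\<Phi> \<in> Units (tensor_cube H)"
    and pentagon:
      "tensor_map (ixs H) (ixs H \<times> ixs H) id (tensor_map (ixs H) (ixs H) id \<Delta>) \<Phi>
         \<otimes>\<^bsub>tensor_fourth H\<^esub> reassoc (tensor_map (ixs H) (ixs H \<times> ixs H) \<Delta> id \<Phi>)
       = tensor \<one> \<Phi>
         \<otimes>\<^bsub>tensor_fourth H\<^esub> tensor_map (ixs H) (ixs H \<times> ixs H) id
                              (\<lambda>w. reassoc (tensor_map (ixs H) (ixs H) \<Delta> id w)) \<Phi>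
         \<otimes>\<^bsub>tensor_fourth H\<^esub> (\<lambda>(a, b, c, d). \<Phi> (a, b, c) * \<one> d)"
    and counit_assoc:
      "(\<lambda>(a, c). \<Sum>b\<in>ixs H. \<Phi> (a, b, c) * \<epsilon> (bv b)) = \<one>\<^bsub>tensor_sq H\<^esub>"
    and counit_left: "\<And>h. h \<in> carrier H \<Longrightarrow> (\<lambda>b. \<Sum>a\<in>ixs H. \<epsilon> (bv a) * \<Delta> h (a, b)) = h"
    and counit_right: "\<And>h. h \<in> carrier H \<Longrightarrow> (\<lambda>a. \<Sum>b\<in>ixs H. \<Delta> h (a, b) * \<epsilon> (bv b)) = h"
    and quasi_coassoc: "\<And>h. h \<in> carrier H \<Longrightarrow>
          \<Phi> \<otimes>\<^bsub>tensor_cube H\<^esub> reassoc (tensor_map (ixs H) (ixs H) \<Delta> id (\<Delta> h))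
            \<otimes>\<^bsub>tensor_cube H\<^esub> inv\<^bsub>tensor_cube H\<^esub> \<Phi>
          = tensor_map (ixs H) (ixs H) id \<Delta> (\<Delta> h)"

text \<open>Sweedler-type expressions are expanded in the basis: for
  \<open>\<Delta> h = \<Sum> \<Delta> h (a, b) \<cdot> (bv a \<otimes> bv b)\<close>, the expression \<open>h\<^sub>1 \<beta> S(h\<^sub>2)\<close> is
  \<open>\<Sum> \<Delta> h (a, b) \<cdot> (bv a \<beta> S (bv b))\<close>.\<close>

locale quasi_hopf_algebra = quasi_bialgebra H \<Delta> \<epsilon> \<Phi>
  for H :: "('b, 'k::field) based_alg" (structure) and \<Delta> \<epsilon> \<Phi> +
  fixes S :: "('b \<Rightarrow> 'k) \<Rightarrow> 'b \<Rightarrow> 'k"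
    and \<alpha> :: "'b \<Rightarrow> 'k"
    and \<beta> :: "'b \<Rightarrow> 'k"
  assumes antipode_linear: "linear_map_on (ixs H) (ixs H) S"
    and antipode_bij: "bij_betw S (carrier H) (carrier H)"
    and antipode_mult: "\<And>a b. a \<in> carrier H \<Longrightarrow> b \<in> carrier H \<Longrightarrow> S (a \<otimes> b) = S b \<otimes> S a"
    and antipode_one: "S \<one> = \<one>"
    and \<alpha>_closed: "\<alpha> \<in> carrier H"
    and \<beta>_closed: "\<beta> \<in> carrier H"
    and antipode_\<alpha>: "\<And>h. h \<in> carrier H \<Longrightarrow>
          (\<lambda>d. \<Sum>(a, b)\<in>ixs H \<times> ixs H. \<Delta> h (a, b) * (S (bv a) \<otimes> \<alpha> \<otimes> bv b) d) = scale (\<epsilon> h) \<alpha>"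
    and antipode_\<beta>: "\<And>h. h \<in> carrier H \<Longrightarrow>
          (\<lambda>d. \<Sum>(a, b)\<in>ixs H \<times> ixs H. \<Delta> h (a, b) * (bv a \<otimes> \<beta> \<otimes> S (bv b)) d) = scale (\<epsilon> h) \<beta>"
    and antipode_assoc:
      "(\<lambda>d. \<Sum>(a, b, c)\<in>ixs H \<times> ixs H \<times> ixs H.
          \<Phi> (a, b, c) * (bv a \<otimes> \<beta> \<otimes> S (bv b) \<otimes> \<alpha> \<otimes> bv c) d) = \<one>"
    and antipode_assoc_inv:
      "(\<lambda>d. \<Sum>(a, b, c)\<in>ixs H \<times> ixs H \<times> ixs H.
          (inv\<^bsub>tensor_cube H\<^esub> \<Phi>) (a, b, c) * (S (bv a) \<otimes> \<alpha> \<otimes> bv b \<otimes> \<beta> \<otimes> S (bv c)) d) = \<one>"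

section \<open>Transversals and the induced operations\<close>

text \<open>\<open>F #> g\<close> is the coset \<open>Fg\<close> and \<open>g <# F\<close> is the coset \<open>gF\<close>.\<close>

definition two_sided_transversal :: "('g, 'm) monoid_scheme \<Rightarrow> 'g set \<Rightarrow> 'g set \<Rightarrow> bool" where
  "two_sided_transversal G F Q \<longleftrightarrow>
     Q \<subseteq> carrier G \<and> \<one>\<^bsub>G\<^esub> \<in> Q \<and>
     (\<forall>g\<in>carrier G. \<exists>!q. q \<in> Q \<and> q \<in> F #>\<^bsub>G\<^esub> g) \<and>
     (\<forall>g\<in>carrier G. \<exists>!q. q \<in> Q \<and> q \<in> g <#\<^bsub>G\<^esub> F)"

text \<open>The components of the factorization \<open>g = xq\<close> with \<open>x \<in> F\<close>, \<open>q \<in> Q\<close>.\<close>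

definition F_part :: "('g, 'm) monoid_scheme \<Rightarrow> 'g set \<Rightarrow> 'g set \<Rightarrow> 'g \<Rightarrow> 'g" where
  "F_part G F Q g = (THE x. x \<in> F \<and> (\<exists>q\<in>Q. g = x \<otimes>\<^bsub>G\<^esub> q))"

definition Q_part :: "('g, 'm) monoid_scheme \<Rightarrow> 'g set \<Rightarrow> 'g set \<Rightarrow> 'g \<Rightarrow> 'g" where
  "Q_part G F Q g = (THE q. q \<in> Q \<and> (\<exists>x\<in>F. g = x \<otimes>\<^bsub>G\<^esub> q))"

text \<open>\<open>actF\<close> is \<open>q \<triangleright> x\<close>, \<open>actQ\<close> is \<open>q \<triangleleft> x\<close>, \<open>dotQ\<close> is \<open>p.q\<close>, \<open>thetaF\<close> is \<open>\<theta>(p, q)\<close>,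
  \<open>linvQ\<close> is \<open>p\<^sup>L\<close>, \<open>rinvQ\<close> is \<open>p\<^sup>R\<close> and \<open>succF\<close> is \<open>p \<succ> x\<close>.\<close>

definition actF :: "('g, 'm) monoid_scheme \<Rightarrow> 'g set \<Rightarrow> 'g set \<Rightarrow> 'g \<Rightarrow> 'g \<Rightarrow> 'g" where
  "actF G F Q q x = F_part G F Q (q \<otimes>\<^bsub>G\<^esub> x)"

definition actQ :: "('g, 'm) monoid_scheme \<Rightarrow> 'g set \<Rightarrow> 'g set \<Rightarrow> 'g \<Rightarrow> 'g \<Rightarrow> 'g" where
  "actQ G F Q q x = Q_part G F Q (q \<otimes>\<^bsub>G\<^esub> x)"

definition dotQ :: "('g, 'm) monoid_scheme \<Rightarrow> 'g set \<Rightarrow> 'g set \<Rightarrow> 'g \<Rightarrow> 'g \<Rightarrow> 'g" where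
  "dotQ G F Q p q = Q_part G F Q (p \<otimes>\<^bsub>G\<^esub> q)"

definition thetaF :: "('g, 'm) monoid_scheme \<Rightarrow> 'g set \<Rightarrow> 'g set \<Rightarrow> 'g \<Rightarrow> 'g \<Rightarrow> 'g" where
  "thetaF G F Q p q = F_part G F Q (p \<otimes>\<^bsub>G\<^esub> q)"

definition linvQ :: "('g, 'm) monoid_scheme \<Rightarrow> 'g set \<Rightarrow> 'g set \<Rightarrow> 'g \<Rightarrow> 'g" where
  "linvQ G F Q p = (THE r. r \<in> Q \<and> dotQ G F Q r p = \<one>\<^bsub>G\<^esub>)"

definition rinvQ :: "('g, 'm) monoid_scheme \<Rightarrow> 'g set \<Rightarrow> 'g set \<Rightarrow> 'g \<Rightarrow> 'g" where
  "rinvQ G F Q p = (THE r. r \<in> Q \<and> dotQ G F Q p r = \<one>\<^bsub>G\<^esub>)"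

definition succF :: "('g, 'm) monoid_scheme \<Rightarrow> 'g set \<Rightarrow> 'g set \<Rightarrow> 'g \<Rightarrow> 'g \<Rightarrow> 'g" where
  "succF G F Q p x =
     inv\<^bsub>G\<^esub> (thetaF G F Q p (rinvQ G F Q p)) \<otimes>\<^bsub>G\<^esub> actF G F Q p x
       \<otimes>\<^bsub>G\<^esub> thetaF G F Q (actQ G F Q p x) (rinvQ G F Q (actQ G F Q p x))"

section \<open>The 3-cocycle and the algebra it defines\<close>

definition normalized_3cocycle ::
  "('g, 'm) monoid_scheme \<Rightarrow> ('g \<Rightarrow> 'g \<Rightarrow> 'g \<Rightarrow> 'k::field) \<Rightarrow> bool" where
  "normalized_3cocycle G \<omega> \<longleftrightarrow>
     (\<forall>a\<in>carrier G. \<forall>b\<in>carrier G. \<forall>c\<in>carrier G. \<omega> a b c \<noteq> 0) \<and>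
     (\<forall>a\<in>carrier G. \<forall>b\<in>carrier G. \<forall>c\<in>carrier G. \<forall>d\<in>carrier G.
        \<omega> (a \<otimes>\<^bsub>G\<^esub> b) c d * \<omega> a b (c \<otimes>\<^bsub>G\<^esub> d)
        = \<omega> a b c * \<omega> a (b \<otimes>\<^bsub>G\<^esub> c) d * \<omega> b c d) \<and>
     (\<forall>a\<in>carrier G. \<forall>b\<in>carrier G.
        \<omega> \<one>\<^bsub>G\<^esub> a b = 1 \<and> \<omega> a \<one>\<^bsub>G\<^esub> b = 1 \<and> \<omega> a b \<one>\<^bsub>G\<^esub> = 1)"

definition sigma :: "('g \<Rightarrow> 'g \<Rightarrow> 'g \<Rightarrow> 'k) \<Rightarrow> 'g \<Rightarrow> 'g \<Rightarrow> 'g \<Rightarrow> 'k" where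
  "sigma \<omega> p x y = \<omega> p x y"

definition tau :: "('g \<Rightarrow> 'g \<Rightarrow> 'g \<Rightarrow> 'k) \<Rightarrow> 'g \<Rightarrow> 'g \<Rightarrow> 'g \<Rightarrow> 'k" where
  "tau \<omega> x p q = \<omega> p q x"

text \<open>The basis element \<open>\<delta>\<^sub>p x\<close> is \<open>bv (p, x)\<close>.\<close>

definition smash_alg :: "('g, 'm) monoid_scheme \<Rightarrow> 'g set \<Rightarrow> 'g set \<Rightarrow>
    ('g \<Rightarrow> 'g \<Rightarrow> 'g \<Rightarrow> 'k::field) \<Rightarrow> ('g \<times> 'g, 'k) based_alg" where
  "smash_alg G F Q \<omega> =
     \<lparr> carrier = vec_on (Q \<times> F),
       monoid.mult = (\<lambda>v w d. \<Sum>(p, x)\<in>Q \<times> F. \<Sum>(q, y)\<in>Q \<times> F. v (p, x) * w (q, y) *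
          ((if actQ G F Q p x = q then 1 else 0) * sigma \<omega> p x y * bv (p, x \<otimes>\<^bsub>G\<^esub> y) d)),
       one = (\<lambda>d. \<Sum>p\<in>Q. bv (p, \<one>\<^bsub>G\<^esub>) d),
       ixs = Q \<times> F \<rparr>"

definition smash_comult :: "('g, 'm) monoid_scheme \<Rightarrow> 'g set \<Rightarrow> 'g set \<Rightarrow>
    ('g \<Rightarrow> 'g \<Rightarrow> 'g \<Rightarrow> 'k::field) \<Rightarrow> ('g \<times> 'g \<Rightarrow> 'k) \<Rightarrow> ('g \<times> 'g) \<times> ('g \<times> 'g) \<Rightarrow> 'k" where
  "smash_comult G F Q \<omega> v =
     (\<lambda>d. \<Sum>(p, x)\<in>Q \<times> F. v (p, x) *
        (\<Sum>(s, t)\<in>{(s, t). s \<in> Q \<and> t \<in> Q \<and> dotQ G F Q s t = p}.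
           tau \<omega> x s t * tensor (bv (s, actF G F Q t x)) (bv (t, x)) d))"

definition smash_counit :: "('g, 'm) monoid_scheme \<Rightarrow> 'g set \<Rightarrow> 'g set \<Rightarrow>
    ('g \<times> 'g \<Rightarrow> 'k::field) \<Rightarrow> 'k" where
  "smash_counit G F Q v = (\<Sum>(p, x)\<in>Q \<times> F. v (p, x) * (if p = \<one>\<^bsub>G\<^esub> then 1 else 0))"

definition smash_associator :: "('g, 'm) monoid_scheme \<Rightarrow> 'g set \<Rightarrow> 'g set \<Rightarrow>
    ('g \<Rightarrow> 'g \<Rightarrow> 'g \<Rightarrow> 'k::field) \<Rightarrow> ('g \<times> 'g) \<times> ('g \<times> 'g) \<times> ('g \<times> 'g) \<Rightarrow> 'k" where
  "smash_associator G F Q \<omega> =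
     (\<lambda>d. \<Sum>(p, q, r)\<in>Q \<times> Q \<times> Q. \<omega> p q r *
        tensor (bv (p, thetaF G F Q q r)) (tensor (bv (q, \<one>\<^bsub>G\<^esub>)) (bv (r, \<one>\<^bsub>G\<^esub>))) d)"

end

theory Submission
  imports Defs
begin

text \<open>
  The algebra \<open>A\<close> is the \<open>\<omega>\<close>-twisted groupoid algebra of the right action \<open>\<triangleleft>\<close> of \<open>F\<close> on \<open>Q\<close>:
  \<open>\<delta>\<^sub>p x\<close> is an arrow from \<open>p\<close> to \<open>p \<triangleleft> x\<close>, and tensor powers of \<open>A\<close> are twisted algebras of the
  product groupoids. Every structure element (\<open>\<Delta> h\<close>, \<open>\<Phi>\<close>, \<open>\<beta>\<close>, \<dots>) is a linear combination of
  arrows indexed by tuples in \<open>Q\<close> and \<open>F\<close>, so each axiom becomes an equality of arrows in \<open>G\<close> together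
  with a monomial identity between values of \<open>\<omega>\<close>. These follow from the cocycle identity
  because the normalization determines \<open>\<omega>\<close> by factorization: for \<open>x \<in> F\<close> and \<open>q \<in> Q\<close>,
  \<open>\<omega>(xa, b, c) = \<omega>(a, b, c)\<close>, \<open>\<omega>(a, xq, d) = \<omega>(ax, q, d) \<omega>(a, x, qd)\<close> and
  \<open>\<omega>(a, b, xq) = \<omega>(a, b, x) \<omega>(a, bx, q)\<close>.

  For the antipode, put \<open>y = p \<succ> x\<close>. Then \<open>p\<^sup>R y = x (p \<triangleleft> x)\<^sup>R\<close>, so \<open>\<delta>\<^sub>p x\<close> and the arrow \<open>y\<close> at \<open>p\<^sup>R\<close>
  form one term of \<open>\<Delta>(\<delta>\<^sub>e y)\<close>, and \<open>\<S>(\<delta>\<^sub>p x)\<close> is the inverse of the latter arrow divided by the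
  coefficient \<open>\<tau>\<^sub>y(p, p\<^sup>R)\<close> of this term. All computations take place in \<open>A\<close>, since
  the tensor powers of \<open>A\<^sup>o\<^sup>p\<close> are the opposites of those of \<open>A\<close>.
\<close>

section \<open>Linear combinations of basis vectors\<close>

text \<open>The family \<open>\<phi>\<close> need not be injective, so a vector has many
  presentations. Two of them are compared by reindexing, never by collecting the coefficient of each
  basis vector.\<close>

definition lincomb :: "'o set \<Rightarrow> ('o \<Rightarrow> 'k::field) \<Rightarrow> ('o \<Rightarrow> 'b) \<Rightarrow> 'b \<Rightarrow> 'k" where
  "lincomb N \<gamma> \<phi> = (\<lambda>d. \<Sum>n\<in>N. \<gamma> n * bv (\<phi> n) d)"

lemma bv_Pair: "bv (a, b) (c, d) = bv a c * bv b d"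
  by (simp add: bv_def)

lemma tensor_bv: "tensor (bv a) (bv b) = bv (a, b)"
  by (auto simp: tensor_def bv_Pair)

lemma bv_in_vec_on: "b \<in> I \<Longrightarrow> bv b \<in> vec_on I"
  by (auto simp: vec_on_def bv_def)

lemma lincomb_cong:
  "N = N' \<Longrightarrow> (\<And>n. n \<in> N' \<Longrightarrow> \<gamma> n = \<gamma>' n) \<Longrightarrow> (\<And>n. n \<in> N' \<Longrightarrow> \<phi> n = \<phi>' n)
    \<Longrightarrow> lincomb N \<gamma> \<phi> = lincomb N' \<gamma>' \<phi>'"
  by (auto simp: lincomb_def intro!: ext sum.cong)

text \<open>The main device for equating two presentations: a bijection of the index sets reduces
  the claim to equal coefficients and equal basis elements, index by index.\<close>

lemma lincomb_bij_witness:
  assumes "\<And>n. n \<in> N \<Longrightarrow> i (j n) = n" "\<And>n. n \<in> N \<Longrightarrow> j n \<in> P"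
    and "\<And>p. p \<in> P \<Longrightarrow> j (i p) = p" "\<And>p. p \<in> P \<Longrightarrow> i p \<in> N"
    and "\<And>p. p \<in> P \<Longrightarrow> \<gamma> (i p) = \<gamma>' p" "\<And>p. p \<in> P \<Longrightarrow> \<phi> (i p) = \<phi>' p"
  shows "lincomb N \<gamma> \<phi> = lincomb P \<gamma>' \<phi>'"
  unfolding lincomb_def
proof
  show "(\<Sum>n\<in>N. \<gamma> n * bv (\<phi> n) d) = (\<Sum>n\<in>P. \<gamma>' n * bv (\<phi>' n) d)" for d
    by (rule sum.reindex_bij_witness[where i = i and j = j]) (use assms in \<open>simp_all flip: assms(5,6)\<close>)
qed

lemma lincomb_closed: "\<phi> ` N \<subseteq> I \<Longrightarrow> lincomb N \<gamma> \<phi> \<in> vec_on I"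
  by (auto simp: lincomb_def vec_on_def bv_def intro!: sum.neutral)

lemma lincomb_singleton: "lincomb {n} \<gamma> \<phi> = scale (\<gamma> n) (bv (\<phi> n))"
  by (simp add: lincomb_def scale_def)

lemma bv_eq_lincomb: "bv b = lincomb {()} (\<lambda>_. 1) (\<lambda>_. b)"
  by (simp add: lincomb_def)

lemma scale_lincomb: "scale c (lincomb N \<gamma> \<phi>) = lincomb N (\<lambda>n. c * \<gamma> n) \<phi>"
  by (simp add: lincomb_def scale_def sum_distrib_left mult.assoc)

lemma vec_eq_lincomb:
  assumes "finite I" "v \<in> vec_on I"
  shows "v = lincomb I v (\<lambda>b. b)"
  using assms by (auto simp: lincomb_def vec_on_def bv_def if_distrib[of "\<lambda>x. _ * x"] cong: if_cong)

text \<open>After exchanging the two sums, each basis vector picks out a single summand. This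
  evaluates the basis expansions that stand for Sweedler notation.\<close>

lemma sum_lincomb:
  assumes "finite I" "\<phi> ` N \<subseteq> I"
  shows "(\<Sum>b\<in>I. lincomb N \<gamma> \<phi> b * f b) = (\<Sum>n\<in>N. \<gamma> n * f (\<phi> n))"
proof -
  have "(\<Sum>b\<in>I. lincomb N \<gamma> \<phi> b * f b) = (\<Sum>b\<in>I. \<Sum>n\<in>N. \<gamma> n * bv (\<phi> n) b * f b)"
    by (simp add: lincomb_def sum_distrib_right)
  also have "\<dots> = (\<Sum>n\<in>N. \<Sum>b\<in>I. \<gamma> n * bv (\<phi> n) b * f b)"
    by (rule sum.swap)
  also have "\<dots> = (\<Sum>n\<in>N. \<gamma> n * f (\<phi> n))"
  proof (rule sum.cong)
    fix n assume "n \<in> N"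
    then have "\<phi> n \<in> I" using assms by auto
    have "(\<Sum>b\<in>I. \<gamma> n * bv (\<phi> n) b * f b) = (\<Sum>b\<in>I. if b = \<phi> n then \<gamma> n * f b else 0)"
      by (rule sum.cong) (auto simp: bv_def)
    also have "\<dots> = \<gamma> n * f (\<phi> n)"
      using \<open>\<phi> n \<in> I\<close> assms by simp
    finally show "(\<Sum>b\<in>I. \<gamma> n * bv (\<phi> n) b * f b) = \<gamma> n * f (\<phi> n)" .
  qed simp
  finally show ?thesis .
qed

lemma sum2_lincomb:
  assumes "finite I" "finite J" "\<phi> ` N \<subseteq> I \<times> J"
  shows "(\<Sum>(a, b)\<in>I \<times> J. lincomb N \<gamma> \<phi> (a, b) * f a b)
    = (\<Sum>n\<in>N. \<gamma> n * f (fst (\<phi> n)) (snd (\<phi> n)))"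
  using sum_lincomb[of "I \<times> J" \<phi> N \<gamma> "\<lambda>(a, b). f a b"] assms
  by (simp add: case_prod_unfold)

lemma sum3_lincomb:
  assumes "finite I" "finite J" "finite K" "\<phi> ` N \<subseteq> I \<times> J \<times> K"
  shows "(\<Sum>(a, b, c)\<in>I \<times> J \<times> K. lincomb N \<gamma> \<phi> (a, b, c) * f a b c)
    = (\<Sum>n\<in>N. \<gamma> n * f (fst (\<phi> n)) (fst (snd (\<phi> n))) (snd (snd (\<phi> n))))"
  using sum_lincomb[of "I \<times> J \<times> K" \<phi> N \<gamma> "\<lambda>(a, b, c). f a b c"] assms
  by (simp add: case_prod_unfold)

lemma sum_lincomb_SIGMA:
  assumes "finite N" "\<And>n. n \<in> N \<Longrightarrow> finite (P n)"
  shows "(\<lambda>d. \<Sum>n\<in>N. \<gamma> n * lincomb (P n) (\<gamma>' n) (\<phi> n) d)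
    = lincomb (SIGMA n:N. P n) (\<lambda>(n, p). \<gamma> n * \<gamma>' n p) (\<lambda>(n, p). \<phi> n p)"
  using assms
  by (auto simp: lincomb_def sum_distrib_left sum.Sigma mult.assoc case_prod_unfold intro!: ext)

lemma tensor_lincomb:
  "tensor (lincomb N \<gamma> \<phi>) (lincomb N' \<gamma>' \<phi>')
    = lincomb (N \<times> N') (\<lambda>(n, n'). \<gamma> n * \<gamma>' n') (\<lambda>(n, n'). (\<phi> n, \<phi>' n'))"
  by (auto simp: tensor_def lincomb_def sum_product sum.cartesian_product bv_Pair
      intro!: ext sum.cong)

text \<open>The index sets \<open>P n\<close> and \<open>R n\<close> depend on \<open>n\<close>
  because the comultiplication of a basis vector is a sum over the factorizations of its own
  index.\<close>

lemma tensor_map_lincomb: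
  assumes "finite I" "finite J" "finite N" "\<phi> ` N \<subseteq> I \<times> J"
    and "\<And>n. n \<in> N \<Longrightarrow> finite (P n)" "\<And>n. n \<in> N \<Longrightarrow> finite (R n)"
    and "\<And>n. n \<in> N \<Longrightarrow> f (bv (fst (\<phi> n))) = lincomb (P n) (\<gamma>1 n) (\<phi>1 n)"
    and "\<And>n. n \<in> N \<Longrightarrow> g (bv (snd (\<phi> n))) = lincomb (R n) (\<gamma>2 n) (\<phi>2 n)"
  shows "tensor_map I J f g (lincomb N \<gamma> \<phi>)
    = lincomb (SIGMA n:N. P n \<times> R n) (\<lambda>(n, p, r). \<gamma> n * (\<gamma>1 n p * \<gamma>2 n r))
        (\<lambda>(n, p, r). (\<phi>1 n p, \<phi>2 n r))"
proof -
  have "tensor_map I J f g (lincomb N \<gamma> \<phi>)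
    = (\<lambda>d. \<Sum>n\<in>N. \<gamma> n * tensor (f (bv (fst (\<phi> n)))) (g (bv (snd (\<phi> n)))) d)"
    unfolding tensor_map_def
    by (rule ext, rule sum2_lincomb) (use assms in auto)
  also have "\<dots> = (\<lambda>d. \<Sum>n\<in>N. \<gamma> n * lincomb (P n \<times> R n)
      (\<lambda>(p, r). \<gamma>1 n p * \<gamma>2 n r) (\<lambda>(p, r). (\<phi>1 n p, \<phi>2 n r)) d)"
    using assms by (simp add: tensor_lincomb)
  also have "\<dots> = lincomb (SIGMA n:N. P n \<times> R n) (\<lambda>(n, p, r). \<gamma> n * (\<gamma>1 n p * \<gamma>2 n r))
        (\<lambda>(n, p, r). (\<phi>1 n p, \<phi>2 n r))"
    using assms by (subst sum_lincomb_SIGMA) (auto simp: case_prod_unfold intro!: lincomb_cong)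
  finally show ?thesis .
qed

lemma tensor_map_bv:
  assumes "finite I" "finite J" "a \<in> I" "b \<in> J"
  shows "tensor_map I J f g (bv (a, b)) = tensor (f (bv a)) (g (bv b))"
proof
  show "tensor_map I J f g (bv (a, b)) d = tensor (f (bv a)) (g (bv b)) d" for d
    using sum2_lincomb[of I J "\<lambda>_. (a, b)" "{()}" "\<lambda>_. 1" "\<lambda>i j. tensor (f (bv i)) (g (bv j)) d"] assms
    by (simp add: tensor_map_def bv_eq_lincomb[of "(a, b)"])
qed

lemma reassoc_lincomb:
  "reassoc (lincomb N \<gamma> \<phi>)
    = lincomb N \<gamma> (\<lambda>n. (fst (fst (\<phi> n)), snd (fst (\<phi> n)), snd (\<phi> n)))"
  by (auto simp: reassoc_def lincomb_def bv_def prod_eq_iff intro!: ext sum.cong)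

lemma scale_one [simp]: "scale 1 v = v"
  by (simp add: scale_def)

lemma id_bv: "id (bv b) = lincomb {()} (\<lambda>_. 1) (\<lambda>_. b)"
  by (simp add: bv_eq_lincomb)

lemma lincomb_supp:
  assumes "finite N" "M \<subseteq> N" "\<And>n. n \<in> N - M \<Longrightarrow> \<gamma> n = 0"
  shows "lincomb N \<gamma> \<phi> = lincomb M \<gamma> \<phi>"
  unfolding lincomb_def using assms by (intro ext sum.mono_neutral_right) auto

text \<open>Contraction of one tensor slot, as in the counit axioms: \<open>h\<close> inserts
  \<open>b\<close> into the contracted slot, \<open>\<psi>\<close> is the component of
  \<open>\<phi>\<close> there, and \<open>\<chi>\<close> collects the remaining components.\<close>

lemma sum_lincomb_contract:
  fixes \<gamma> :: "'n \<Rightarrow> 'k::field" and \<phi> :: "'n \<Rightarrow> 'c"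
  assumes "finite I" "\<And>n. n \<in> N \<Longrightarrow> \<psi> n \<in> I"
    and "\<And>n b. n \<in> N \<Longrightarrow> bv (\<phi> n) (h b) = (bv (\<psi> n) b * bv (\<chi> n) d :: 'k)"
  shows "(\<Sum>b\<in>I. lincomb N \<gamma> \<phi> (h b) * e b) = lincomb N (\<lambda>n. \<gamma> n * e (\<psi> n)) \<chi> d"
proof -
  have "(\<Sum>b\<in>I. lincomb N \<gamma> \<phi> (h b) * e b) = (\<Sum>b\<in>I. lincomb N (\<lambda>n. \<gamma> n * bv (\<chi> n) d) \<psi> b * e b)"
    using assms(3) by (auto simp: lincomb_def mult_ac intro!: sum.cong)
  also have "\<dots> = lincomb N (\<lambda>n. \<gamma> n * e (\<psi> n)) \<chi> d"
    using assms by (subst sum_lincomb) (auto simp: lincomb_def mult_ac)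
  finally show ?thesis .
qed

section \<open>Algebras with a multiplicative basis up to scalars\<close>

text \<open>The product of two basis vectors \<open>a\<close>, \<open>b\<close> is \<open>c a b\<close> times the basis vector \<open>m a b\<close>.
  A twisted groupoid algebra has this form, with \<open>c a b = 0\<close> when \<open>a\<close>, \<open>b\<close> do not compose.\<close>

locale monomial_mult =
  fixes H :: "('b, 'k::field) based_alg" (structure)
    and c :: "'b \<Rightarrow> 'b \<Rightarrow> 'k" and m :: "'b \<Rightarrow> 'b \<Rightarrow> 'b"
  assumes finite_ixs: "finite (ixs H)"
    and carrier_eq: "carrier H = vec_on (ixs H)"
    and mult_eq: "monoid.mult H = (\<lambda>v w d. \<Sum>a\<in>ixs H. \<Sum>b\<in>ixs H. v a * w b * (c a b * bv (m a b) d))"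
    and m_closed: "a \<in> ixs H \<Longrightarrow> b \<in> ixs H \<Longrightarrow> m a b \<in> ixs H"
    and m_assoc: "a \<in> ixs H \<Longrightarrow> b \<in> ixs H \<Longrightarrow> d \<in> ixs H \<Longrightarrow> m (m a b) d = m a (m b d)"
    and c_assoc: "a \<in> ixs H \<Longrightarrow> b \<in> ixs H \<Longrightarrow> d \<in> ixs H \<Longrightarrow>
      c a b * c (m a b) d = c b d * c a (m b d)"
begin

lemma lincomb_mult_all:
  assumes "\<phi> ` N \<subseteq> ixs H" "\<phi>' ` N' \<subseteq> ixs H"
  shows "lincomb N \<gamma> \<phi> \<otimes> lincomb N' \<gamma>' \<phi>'
    = lincomb (N \<times> N') (\<lambda>(n, n'). \<gamma> n * \<gamma>' n' * c (\<phi> n) (\<phi>' n'))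
        (\<lambda>(n, n'). m (\<phi> n) (\<phi>' n'))"
proof
  fix d
  have "(lincomb N \<gamma> \<phi> \<otimes> lincomb N' \<gamma>' \<phi>') d
    = (\<Sum>a\<in>ixs H. lincomb N \<gamma> \<phi> a * (\<Sum>b\<in>ixs H. lincomb N' \<gamma>' \<phi>' b * (c a b * bv (m a b) d)))"
    by (simp add: mult_eq sum_distrib_left mult.assoc)
  also have "\<dots> = (\<Sum>n\<in>N. \<gamma> n * (\<Sum>n'\<in>N'. \<gamma>' n' * (c (\<phi> n) (\<phi>' n') * bv (m (\<phi> n) (\<phi>' n')) d)))"
    using assms finite_ixs by (simp add: sum_lincomb)
  also have "\<dots> = lincomb (N \<times> N') (\<lambda>(n, n'). \<gamma> n * \<gamma>' n' * c (\<phi> n) (\<phi>' n'))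
        (\<lambda>(n, n'). m (\<phi> n) (\<phi>' n')) d"
    by (simp add: lincomb_def sum_distrib_left sum.cartesian_product case_prod_unfold mult.assoc)
  finally show "(lincomb N \<gamma> \<phi> \<otimes> lincomb N' \<gamma>' \<phi>') d = \<dots>" .
qed

text \<open>The index set \<open>P\<close> lists at least all composable pairs.\<close>

lemma lincomb_mult:
  assumes "finite N" "finite N'" "\<phi> ` N \<subseteq> ixs H" "\<phi>' ` N' \<subseteq> ixs H"
    and "inj_on (\<lambda>p. (f p, g p)) P" "\<And>p. p \<in> P \<Longrightarrow> f p \<in> N" "\<And>p. p \<in> P \<Longrightarrow> g p \<in> N'"
    and "\<And>n n'. n \<in> N \<Longrightarrow> n' \<in> N' \<Longrightarrow> c (\<phi> n) (\<phi>' n') \<noteq> 0 \<Longrightarrow> \<exists>p\<in>P. n = f p \<and> n' = g p"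
  shows "lincomb N \<gamma> \<phi> \<otimes> lincomb N' \<gamma>' \<phi>'
    = lincomb P (\<lambda>p. \<gamma> (f p) * \<gamma>' (g p) * c (\<phi> (f p)) (\<phi>' (g p)))
        (\<lambda>p. m (\<phi> (f p)) (\<phi>' (g p)))"
proof
  fix d
  let ?t = "\<lambda>(n, n'). \<gamma> n * \<gamma>' n' * c (\<phi> n) (\<phi>' n') * bv (m (\<phi> n) (\<phi>' n')) d"
  have "(lincomb N \<gamma> \<phi> \<otimes> lincomb N' \<gamma>' \<phi>') d = sum ?t (N \<times> N')"
    by (subst lincomb_mult_all[OF assms(3,4)]) (simp add: lincomb_def case_prod_unfold)
  also have "\<dots> = sum ?t ((\<lambda>p. (f p, g p)) ` P)"
  proof (rule sum.mono_neutral_right)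
    show "\<forall>i\<in>N \<times> N' - (\<lambda>p. (f p, g p)) ` P. ?t i = 0"
    proof
      fix i assume "i \<in> N \<times> N' - (\<lambda>p. (f p, g p)) ` P"
      then have "c (\<phi> (fst i)) (\<phi>' (snd i)) = 0"
        using assms(8)[of "fst i" "snd i"] by (cases i) auto
      then show "?t i = 0" by (simp add: case_prod_unfold)
    qed
  qed (use assms in auto)
  also have "\<dots> = (\<Sum>p\<in>P. ?t (f p, g p))"
    using assms(5) by (simp add: sum.reindex)
  finally show "(lincomb N \<gamma> \<phi> \<otimes> lincomb N' \<gamma>' \<phi>') d
    = lincomb P (\<lambda>p. \<gamma> (f p) * \<gamma>' (g p) * c (\<phi> (f p)) (\<phi>' (g p)))
        (\<lambda>p. m (\<phi> (f p)) (\<phi>' (g p))) d"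
    by (simp add: lincomb_def)
qed

lemma bv_mult: "a \<in> ixs H \<Longrightarrow> b \<in> ixs H \<Longrightarrow> bv a \<otimes> bv b = scale (c a b) (bv (m a b))"
  using lincomb_mult_all[of "\<lambda>_. a" "{()}" "\<lambda>_. b" "{()}" "\<lambda>_. 1" "\<lambda>_. 1"]
  by (simp add: bv_eq_lincomb[symmetric] lincomb_def scale_def)

lemma mult_closed: "v \<otimes> w \<in> vec_on (ixs H)"
  using m_closed by (auto simp: mult_eq vec_on_def bv_def intro!: sum.neutral)

lemma mult_vadd_left: "vadd v w \<otimes> u = vadd (v \<otimes> u) (w \<otimes> u)"
  by (auto simp: mult_eq vadd_def sum.distrib distrib_right)

lemma mult_vadd_right: "u \<otimes> vadd v w = vadd (u \<otimes> v) (u \<otimes> w)"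
  by (auto simp: mult_eq vadd_def sum.distrib distrib_left distrib_right)

lemma mult_scale_left: "scale r v \<otimes> w = scale r (v \<otimes> w)"
  by (auto simp: mult_eq scale_def sum_distrib_left mult.assoc)

lemma mult_scale_right: "v \<otimes> scale r w = scale r (v \<otimes> w)"
  by (auto simp: mult_eq scale_def sum_distrib_left mult.assoc mult.left_commute intro!: ext sum.cong)

text \<open>Expanded in the basis, both sides are sums over triples. Then \<open>m_assoc\<close>
  matches the basis elements and \<open>c_assoc\<close>, a 2-cocycle condition, matches the
  coefficients.\<close>

lemma mult_assoc:
  assumes "u \<in> vec_on (ixs H)" "v \<in> vec_on (ixs H)" "w \<in> vec_on (ixs H)"
  shows "u \<otimes> v \<otimes> w = u \<otimes> (v \<otimes> w)"
proof -
  let ?I = "ixs H"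
  have "lincomb ?I u (\<lambda>b. b) \<otimes> lincomb ?I v (\<lambda>b. b) \<otimes> lincomb ?I w (\<lambda>b. b)
    = lincomb ?I u (\<lambda>b. b) \<otimes> (lincomb ?I v (\<lambda>b. b) \<otimes> lincomb ?I w (\<lambda>b. b))"
    apply (simp add: lincomb_mult_all m_closed image_subset_iff split: prod.split)
    apply (rule lincomb_bij_witness[where i = "\<lambda>(a, b, d). ((a, b), d)" and j = "\<lambda>((a, b), d). (a, b, d)"])
    by (auto simp: m_assoc c_assoc mult.assoc mult.left_commute[of "c _ _" "w _"])
  then show ?thesis
    using vec_eq_lincomb[OF finite_ixs] assms by metis
qed

end

text \<open>The unit is not a basis vector here: in a groupoid algebra it is the sum of all identity
  arrows. By linearity its laws need checking on basis vectors only.\<close>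

locale monomial_algebra = monomial_mult +
  assumes one_closed: "\<one> \<in> vec_on (ixs H)"
    and one_mult_bv: "a \<in> ixs H \<Longrightarrow> \<one> \<otimes> bv a = bv a"
    and mult_one_bv: "a \<in> ixs H \<Longrightarrow> bv a \<otimes> \<one> = bv a"
begin

lemma mult_sum_right:
  assumes "v \<in> vec_on (ixs H)"
  shows "u \<otimes> v = (\<lambda>d. \<Sum>b\<in>ixs H. v b * (u \<otimes> bv b) d)"
proof
  fix d
  have "(\<Sum>b\<in>ixs H. v b * (u \<otimes> bv b) d)
    = (\<Sum>b\<in>ixs H. \<Sum>a\<in>ixs H. \<Sum>b'\<in>ixs H. bv b b' * (v b * u a * (c a b' * bv (m a b') d)))"
    by (simp add: mult_eq sum_distrib_left mult_ac)
  also have "\<dots> = (\<Sum>b\<in>ixs H. \<Sum>a\<in>ixs H. v b * u a * (c a b * bv (m a b) d))"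
    using finite_ixs by (simp add: bv_def of_bool_def if_distrib[of "\<lambda>x. x * _"] cong: if_cong)
  also have "\<dots> = (u \<otimes> v) d"
    by (subst sum.swap) (simp add: mult_eq mult_ac)
  finally show "(u \<otimes> v) d = (\<Sum>b\<in>ixs H. v b * (u \<otimes> bv b) d)" ..
qed

lemma mult_sum_left:
  assumes "v \<in> vec_on (ixs H)"
  shows "v \<otimes> u = (\<lambda>d. \<Sum>b\<in>ixs H. v b * (bv b \<otimes> u) d)"
proof
  fix d
  have "(\<Sum>b\<in>ixs H. v b * (bv b \<otimes> u) d)
    = (\<Sum>b\<in>ixs H. \<Sum>a\<in>ixs H. bv b a * (\<Sum>b'\<in>ixs H. v b * u b' * (c a b' * bv (m a b') d)))"
    by (simp add: mult_eq sum_distrib_left mult_ac)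
  also have "\<dots> = (\<Sum>b\<in>ixs H. \<Sum>a\<in>ixs H. v b * u a * (c b a * bv (m b a) d))"
    using finite_ixs by (simp add: bv_def of_bool_def if_distrib[of "\<lambda>x. x * _"] cong: if_cong)
  also have "\<dots> = (v \<otimes> u) d"
    by (simp add: mult_eq mult_ac)
  finally show "(v \<otimes> u) d = (\<Sum>b\<in>ixs H. v b * (bv b \<otimes> u) d)" ..
qed

lemma one_mult:
  assumes "v \<in> vec_on (ixs H)"
  shows "\<one> \<otimes> v = v"
proof -
  have "\<one> \<otimes> v = lincomb (ixs H) v (\<lambda>b. b)"
    unfolding mult_sum_right[OF assms] lincomb_def
    by (rule ext, rule sum.cong) (simp_all add: one_mult_bv)
  then show ?thesis
    using vec_eq_lincomb[OF finite_ixs assms] by simp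
qed

lemma mult_one:
  assumes "v \<in> vec_on (ixs H)"
  shows "v \<otimes> \<one> = v"
proof -
  have "v \<otimes> \<one> = lincomb (ixs H) v (\<lambda>b. b)"
    unfolding mult_sum_left[OF assms] lincomb_def
    by (rule ext, rule sum.cong) (simp_all add: mult_one_bv)
  then show ?thesis
    using vec_eq_lincomb[OF finite_ixs assms] by simp
qed

lemma is_based_algebra: "based_algebra H"
  by unfold_locales
    (auto simp: carrier_eq mult_closed mult_assoc one_closed one_mult mult_one finite_ixs
      linear_map_on_def mult_vadd_left mult_vadd_right mult_scale_left mult_scale_right)

end

section \<open>Opposites and tensor products of monomial algebras\<close>

lemma monomial_algebra_opposite:
  assumes "monomial_algebra H c m"
  shows "monomial_algebra (opposite_alg H) (\<lambda>a b. c b a) (\<lambda>a b. m b a)"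
proof -
  interpret monomial_algebra H c m by fact
  show ?thesis
  proof
    show "monoid.mult (opposite_alg H) = (\<lambda>v w d. \<Sum>a\<in>ixs (opposite_alg H). \<Sum>b\<in>ixs (opposite_alg H).
        v a * w b * (c b a * bv (m b a) d))"
      apply (intro ext)
      by (subst sum.swap) (simp add: opposite_alg_def mult_eq mult_ac)
  qed (use finite_ixs carrier_eq m_closed m_assoc c_assoc one_closed one_mult_bv mult_one_bv
      in \<open>auto simp: opposite_alg_def\<close>)
qed

lemma monomial_algebra_tensor:
  assumes "monomial_algebra H c m" "monomial_algebra K c' m'"
  shows "monomial_algebra (tensor_alg H K) (\<lambda>(a, b) (a', b'). c a a' * c' b b')
    (\<lambda>(a, b) (a', b'). (m a a', m' b b'))"
proof -
  interpret H: monomial_algebra H c m by fact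
  interpret K: monomial_algebra K c' m' by fact
  have ixs: "ixs (tensor_alg H K) = ixs H \<times> ixs K"
    by (simp add: tensor_alg_def)
  have mult: "v \<otimes>\<^bsub>tensor_alg H K\<^esub> w = (\<lambda>d. \<Sum>a\<in>ixs H \<times> ixs K. \<Sum>b\<in>ixs H \<times> ixs K.
      v a * w b * ((case a of (a, b) \<Rightarrow> \<lambda>(a', b'). c a a' * c' b b') b
       * bv ((case a of (a, b) \<Rightarrow> \<lambda>(a', b'). (m a a', m' b b')) b) d))" for v w
    unfolding tensor_alg_def
    by (auto simp: case_prod_unfold H.bv_mult K.bv_mult tensor_def scale_def bv_Pair
        intro!: ext sum.cong)
  \<comment> \<open>Pure tensors multiply factorwise, which reduces the unit laws of the tensor
    product to those of the factors.\<close>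
  have mult_t: "tensor u u' \<otimes>\<^bsub>tensor_alg H K\<^esub> tensor v v'
      = tensor (u \<otimes>\<^bsub>H\<^esub> v) (u' \<otimes>\<^bsub>K\<^esub> v')" for u u' v v'
  proof (rule ext, clarify)
    fix d d'
    show "(tensor u u' \<otimes>\<^bsub>tensor_alg H K\<^esub> tensor v v') (d, d')
        = tensor (u \<otimes>\<^bsub>H\<^esub> v) (u' \<otimes>\<^bsub>K\<^esub> v') (d, d')"
      unfolding mult
      by (simp add: tensor_def H.mult_eq K.mult_eq sum_product sum.cartesian_product'
          bv_Pair sum.swap[where A = "ixs H" and B = "ixs K"] mult_ac)
  qed
  show ?thesis
  proof
    show "\<one>\<^bsub>tensor_alg H K\<^esub> \<in> vec_on (ixs (tensor_alg H K))"
      using H.one_closed K.one_closed by (auto simp: tensor_alg_def vec_on_def tensor_def)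
    show "\<one>\<^bsub>tensor_alg H K\<^esub> \<otimes>\<^bsub>tensor_alg H K\<^esub> bv a = bv a"
      if "a \<in> ixs (tensor_alg H K)" for a
    proof -
      have "\<one>\<^bsub>tensor_alg H K\<^esub> = tensor \<one>\<^bsub>H\<^esub> \<one>\<^bsub>K\<^esub>" by (simp add: tensor_alg_def)
      with that show ?thesis
        by (cases a) (simp add: ixs mult_t H.one_mult_bv K.one_mult_bv flip: tensor_bv)
    qed
    show "bv a \<otimes>\<^bsub>tensor_alg H K\<^esub> \<one>\<^bsub>tensor_alg H K\<^esub> = bv a"
      if "a \<in> ixs (tensor_alg H K)" for a
    proof -
      have "\<one>\<^bsub>tensor_alg H K\<^esub> = tensor \<one>\<^bsub>H\<^esub> \<one>\<^bsub>K\<^esub>" by (simp add: tensor_alg_def)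
      with that show ?thesis
        by (cases a) (simp add: ixs mult_t H.mult_one_bv K.mult_one_bv flip: tensor_bv)
    qed
    show "monoid.mult (tensor_alg H K) = (\<lambda>v w d. \<Sum>a\<in>ixs (tensor_alg H K). \<Sum>b\<in>ixs (tensor_alg H K).
      v a * w b * ((case a of (a, b) \<Rightarrow> \<lambda>(a', b'). c a a' * c' b b') b
       * bv ((case a of (a, b) \<Rightarrow> \<lambda>(a', b'). (m a a', m' b b')) b) d))"
      unfolding ixs by (intro ext) (simp add: mult)
    show "carrier (tensor_alg H K) = vec_on (ixs (tensor_alg H K))"
      by (simp add: tensor_alg_def)
    fix a b d
    assume *: "a \<in> ixs (tensor_alg H K)" "b \<in> ixs (tensor_alg H K)" "d \<in> ixs (tensor_alg H K)"
    let ?c = "\<lambda>(a, b) (a', b'). c a a' * c' b b'"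
    let ?m = "\<lambda>(a, b) (a', b'). (m a a', m' b b')"
    obtain a1 a2 b1 b2 d1 d2 where [simp]: "a = (a1, a2)" "b = (b1, b2)" "d = (d1, d2)"
      by (cases a, cases b, cases d)
    show "?c a b * ?c (?m a b) d = ?c b d * ?c a (?m b d)"
      using * H.c_assoc[of a1 b1 d1] K.c_assoc[of a2 b2 d2]
      by (simp add: ixs) (metis (no_types, opaque_lifting) mult.assoc mult.left_commute)
  qed (use ixs H.finite_ixs K.finite_ixs H.m_closed K.m_closed H.m_assoc K.m_assoc in auto)
qed

lemma ixs_tensor [simp]: "ixs (tensor_alg H K) = ixs H \<times> ixs K"
  by (simp add: tensor_alg_def)

lemma one_tensor: "\<one>\<^bsub>tensor_alg H K\<^esub> = tensor \<one>\<^bsub>H\<^esub> \<one>\<^bsub>K\<^esub>"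
  by (simp add: tensor_alg_def)

lemma opposite_alg_simps [simp]:
  "carrier (opposite_alg H) = carrier H" "\<one>\<^bsub>opposite_alg H\<^esub> = \<one>\<^bsub>H\<^esub>"
  "ixs (opposite_alg H) = ixs H" "v \<otimes>\<^bsub>opposite_alg H\<^esub> w = w \<otimes>\<^bsub>H\<^esub> v"
  by (simp_all add: opposite_alg_def)

text \<open>An equality of whole records, so it rewrites the iterated tensor powers inside the
  axioms and moves every computation from the opposite algebra to \<open>A\<close>.\<close>

lemma tensor_alg_opposite:
  "tensor_alg (opposite_alg H) (opposite_alg K) = opposite_alg (tensor_alg H K)"
proof -
  have "monoid.mult (tensor_alg (opposite_alg H) (opposite_alg K))
      = monoid.mult (opposite_alg (tensor_alg H K))"
  proof (intro ext)
    fix v w d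
    show "(v \<otimes>\<^bsub>tensor_alg (opposite_alg H) (opposite_alg K)\<^esub> w) d
        = (v \<otimes>\<^bsub>opposite_alg (tensor_alg H K)\<^esub> w) d"
      unfolding opposite_alg_simps tensor_alg_def
      by (simp add: case_prod_unfold mult.commute[of "v _"]) (rule sum.swap)
  qed
  then show ?thesis
    by (simp add: tensor_alg_def opposite_alg_def)
qed

lemma Units_opposite [simp]: "Units (opposite_alg H) = Units H"
  by (auto simp: Units_def)

text \<open>An inverse is required to be two-sided, a condition that does not see the order of
  multiplication.\<close>

lemma m_inv_opposite [simp]: "m_inv (opposite_alg H) = m_inv H"
  unfolding m_inv_def by (simp add: conj_commute)

section \<open>Factorizations through a two-sided transversal\<close>

locale group_transversal = group G for G :: "('g, 'm) monoid_scheme" (structure) +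
  fixes F Q :: "'g set"
  assumes finite_carrier: "finite (carrier G)"
    and subgroup_F: "subgroup F G"
    and transversal: "two_sided_transversal G F Q"
begin

abbreviation Fp :: "'g \<Rightarrow> 'g" where "Fp g \<equiv> F_part G F Q g"
abbreviation Qp :: "'g \<Rightarrow> 'g" where "Qp g \<equiv> Q_part G F Q g"
abbreviation R :: "'g \<Rightarrow> 'g" where "R q \<equiv> rinvQ G F Q q"
abbreviation L :: "'g \<Rightarrow> 'g" where "L q \<equiv> linvQ G F Q q"
abbreviation sc :: "'g \<Rightarrow> 'g \<Rightarrow> 'g" where "sc p x \<equiv> succF G F Q p x"

lemma F_carrier [simp]: "x \<in> F \<Longrightarrow> x \<in> carrier G"
  using subgroup.mem_carrier[OF subgroup_F] .

lemma Q_carrier [simp]: "q \<in> Q \<Longrightarrow> q \<in> carrier G"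
  using transversal by (auto simp: two_sided_transversal_def)

lemma one_Q [simp]: "\<one> \<in> Q"
  using transversal by (auto simp: two_sided_transversal_def)

lemma one_F [simp]: "\<one> \<in> F"
  using subgroup.one_closed[OF subgroup_F] .

lemma F_mult [simp]: "x \<in> F \<Longrightarrow> y \<in> F \<Longrightarrow> x \<otimes> y \<in> F"
  using subgroup.m_closed[OF subgroup_F] .

lemma F_inv [simp]: "x \<in> F \<Longrightarrow> inv x \<in> F"
  using subgroup.m_inv_closed[OF subgroup_F] .

lemma finite_F [simp]: "finite F"
  by (rule finite_subset[OF _ finite_carrier]) auto

lemma finite_Q [simp]: "finite Q"
  by (rule finite_subset[OF _ finite_carrier]) auto

lemma inv_cancel_left [simp]:
  "a \<in> carrier G \<Longrightarrow> b \<in> carrier G \<Longrightarrow> inv a \<otimes> (a \<otimes> b) = b"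
  "a \<in> carrier G \<Longrightarrow> b \<in> carrier G \<Longrightarrow> a \<otimes> (inv a \<otimes> b) = b"
  by (simp_all flip: m_assoc)

lemma parts_exist:
  assumes "g \<in> carrier G"
  shows "\<exists>x\<in>F. \<exists>q\<in>Q. g = x \<otimes> q"
proof -
  from assms transversal obtain q where "q \<in> Q" "q \<in> F #> g"
    unfolding two_sided_transversal_def by blast
  then obtain x where "x \<in> F" "q = x \<otimes> g"
    by (auto simp: r_coset_def)
  then show ?thesis
    using assms \<open>q \<in> Q\<close> by (intro bexI[of _ "inv x"] bexI[of _ q]) auto
qed

text \<open>Both \<open>q\<close> and \<open>r\<close> represent the coset \<open>F #> q\<close>,
  which contains only one element of \<open>Q\<close>.\<close>

lemma parts_unique:
  assumes "x \<in> F" "q \<in> Q" "y \<in> F" "r \<in> Q" "x \<otimes> q = y \<otimes> r"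
  shows "x = y" "q = r"
proof -
  have "r = inv y \<otimes> (x \<otimes> q)"
    using assms by simp
  then have "r \<in> F #> q"
    using assms(1-4) by (auto simp: r_coset_def m_assoc[symmetric] intro!: bexI[of _ "inv y \<otimes> x"])
  moreover have "q \<in> F #> q"
    using assms by (auto simp: r_coset_def intro!: bexI[of _ "\<one>"])
  ultimately show "q = r"
    using transversal assms Q_carrier[of q] unfolding two_sided_transversal_def by blast
  then show "x = y"
    using assms by simp
qed

lemma parts_mult [simp]:
  assumes "x \<in> F" "q \<in> Q"
  shows "Fp (x \<otimes> q) = x" "Qp (x \<otimes> q) = q"
  using assms unfolding F_part_def Q_part_def by (auto intro!: the_equality dest: parts_unique)

lemma parts_closed [simp]:
  assumes "g \<in> carrier G"
  shows "Fp g \<in> F" "Qp g \<in> Q"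
  using parts_exist[OF assms] by auto

lemma Fp_mult_Qp [simp]: "g \<in> carrier G \<Longrightarrow> Fp g \<otimes> Qp g = g"
  using parts_exist[of g] by auto

lemma Fp_mult_Qp_mult [simp]:
  "g \<in> carrier G \<Longrightarrow> h \<in> carrier G \<Longrightarrow> Fp g \<otimes> (Qp g \<otimes> h) = g \<otimes> h"
  by (simp flip: m_assoc)

lemma Qp_eq: "g \<in> carrier G \<Longrightarrow> Qp g = inv (Fp g) \<otimes> g"
  by (metis Fp_mult_Qp F_carrier Q_carrier inv_cancel_left(1) parts_closed)

lemma parts_F_mult [simp]:
  assumes "x \<in> F" "g \<in> carrier G"
  shows "Fp (x \<otimes> g) = x \<otimes> Fp g" "Qp (x \<otimes> g) = Qp g"
proof -
  have "x \<otimes> g = (x \<otimes> Fp g) \<otimes> Qp g"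
    using assms by (simp add: m_assoc)
  moreover have "Fp ((x \<otimes> Fp g) \<otimes> Qp g) = x \<otimes> Fp g" "Qp ((x \<otimes> Fp g) \<otimes> Qp g) = Qp g"
    using assms by (blast intro: parts_mult F_mult parts_closed)+
  ultimately show "Fp (x \<otimes> g) = x \<otimes> Fp g" "Qp (x \<otimes> g) = Qp g"
    by simp_all
qed

lemma parts_Q [simp]: "q \<in> Q \<Longrightarrow> Fp q = \<one>" "q \<in> Q \<Longrightarrow> Qp q = q"
  using parts_mult[of "\<one>" q] by auto

lemma parts_F [simp]: "x \<in> F \<Longrightarrow> Fp x = x" "x \<in> F \<Longrightarrow> Qp x = \<one>"
  using parts_mult[of x "\<one>"] by auto

lemma Qp_eq_one_iff: "g \<in> carrier G \<Longrightarrow> Qp g = \<one> \<longleftrightarrow> g \<in> F"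
  by (metis Fp_mult_Qp parts_F(2) parts_closed(1) r_one F_carrier)

text \<open>\<open>Qp g\<close> differs from \<open>g\<close> by a left factor in \<open>F\<close>,
  and \<open>Qp\<close> depends only on the coset \<open>F #> g\<close>. With
  \<open>g = q \<otimes> x\<close> this is the action law for
  \<open>\<triangleleft>\<close>.\<close>

lemma Qp_Qp_mult [simp]:
  "g \<in> carrier G \<Longrightarrow> h \<in> carrier G \<Longrightarrow> Qp (Qp g \<otimes> h) = Qp (g \<otimes> h)"
  by (simp add: Qp_eq[of g] m_assoc)

text \<open>The matched-pair rule for products: with \<open>g = q \<otimes> x\<close> and
  \<open>h = y\<close> in \<open>F\<close> it reads \<open>(q \<triangleright> x)((q \<triangleleft>
  x) \<triangleright> y) = q \<triangleright> xy\<close>.\<close>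

lemma Fp_mult_Fp [simp]:
  "g \<in> carrier G \<Longrightarrow> h \<in> carrier G \<Longrightarrow> Fp g \<otimes> Fp (Qp g \<otimes> h) = Fp (g \<otimes> h)"
  using parts_F_mult(1)[of "Fp g" "Qp g \<otimes> h"] by simp

section \<open>Left and right inverses in the transversal\<close>

text \<open>The candidates are the elements of \<open>Q\<close> in the coset
  \<open>inv q <# F\<close>. Here it matters that \<open>Q\<close> also represents the cosets
  \<open>gF\<close>.\<close>

lemma rinv_ex1: "q \<in> Q \<Longrightarrow> \<exists>!r. r \<in> Q \<and> q \<otimes> r \<in> F"
proof -
  assume q: "q \<in> Q"
  have "r \<in> inv q <# F \<longleftrightarrow> q \<otimes> r \<in> F" if "r \<in> Q" for r
    using q that by (auto simp: l_coset_def intro!: bexI[of _ "q \<otimes> r"])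
  then show ?thesis
    using transversal q inv_closed[OF Q_carrier[OF q]] unfolding two_sided_transversal_def by (metis (no_types, lifting))
qed

lemma rinv:
  assumes "q \<in> Q"
  shows R_closed [simp]: "R q \<in> Q" and mult_R [simp]: "q \<otimes> R q \<in> F"
proof -
  have "R q = (THE r. r \<in> Q \<and> q \<otimes> r \<in> F)"
    unfolding rinvQ_def dotQ_def using assms by (intro arg_cong[where f = The] ext) (auto simp: Qp_eq_one_iff)
  then show "R q \<in> Q" "q \<otimes> R q \<in> F"
    using theI'[OF rinv_ex1[OF assms]] by auto
qed

lemma R_eqI: "q \<in> Q \<Longrightarrow> r \<in> Q \<Longrightarrow> q \<otimes> r \<in> F \<Longrightarrow> R q = r"
  using rinv_ex1[of q] rinv[of q] by blast

text \<open>For \<open>r\<close> in \<open>Q\<close>, the equation \<open>r.q = e\<close> says that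
  \<open>r\<close> lies in the coset \<open>F #> inv q\<close>, whose representative is
  \<open>Qp (inv q)\<close>.\<close>

lemma L_eq: "q \<in> Q \<Longrightarrow> L q = Qp (inv q)"
  unfolding linvQ_def dotQ_def
proof (rule the_equality)
  assume q: "q \<in> Q"
  then show "Qp (inv q) \<in> Q \<and> Qp (Qp (inv q) \<otimes> q) = \<one>"
    by simp
  fix r assume "r \<in> Q \<and> Qp (r \<otimes> q) = \<one>"
  then have r: "r \<in> Q" "r \<otimes> q \<in> F" using q by (auto simp: Qp_eq_one_iff)
  have "inv q = inv (r \<otimes> q) \<otimes> r"
    using q r by (simp add: inv_mult_group m_assoc)
  then show "r = Qp (inv q)"
    using q r by simp
qed

lemma L_closed [simp]: "q \<in> Q \<Longrightarrow> L q \<in> Q"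
  by (simp add: L_eq)

lemma L_mult [simp]: "q \<in> Q \<Longrightarrow> L q \<otimes> q \<in> F"
  using Qp_eq_one_iff[of "L q \<otimes> q"] by (simp add: L_eq)

lemma R_L [simp]: "q \<in> Q \<Longrightarrow> R (L q) = q"
  by (rule R_eqI) auto

lemma L_eqI: "q \<in> Q \<Longrightarrow> r \<in> Q \<Longrightarrow> r \<otimes> q \<in> F \<Longrightarrow> L q = r"
proof -
  assume q: "q \<in> Q" and r: "r \<in> Q" "r \<otimes> q \<in> F"
  have "inv q = inv (r \<otimes> q) \<otimes> r"
    using q r by (simp add: inv_mult_group m_assoc)
  then show "L q = r"
    using q r by (simp add: L_eq)
qed

lemma L_R [simp]: "q \<in> Q \<Longrightarrow> L (R q) = q"
  by (rule L_eqI) auto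

section \<open>The operation \<open>p \<succ> x\<close>\<close>

lemma thetaF_R: "q \<in> Q \<Longrightarrow> thetaF G F Q q (R q) = q \<otimes> R q"
  by (simp add: thetaF_def)

text \<open>Since \<open>q.R q = e\<close>, each \<open>\<theta>(q, R q)\<close> is simply the
  product of \<open>q\<close> and \<open>R q\<close>; the two outer factors then absorb
  \<open>p\<close> and \<open>p \<triangleleft> x\<close>.\<close>

lemma succF_eq:
  assumes "p \<in> Q" "x \<in> F"
  shows "sc p x = inv (R p) \<otimes> x \<otimes> R (Qp (p \<otimes> x))"
  unfolding succF_def actF_def actQ_def
  using assms by (simp add: thetaF_R inv_mult_group m_assoc)

lemma succF_closed [simp]: "p \<in> Q \<Longrightarrow> x \<in> F \<Longrightarrow> sc p x \<in> F"
  unfolding succF_def actF_def actQ_def by (simp add: thetaF_R)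

text \<open>By uniqueness of factorization this gives both
  \<open>R p \<triangleright> (p \<succ> x) = x\<close> and
  \<open>R p \<triangleleft> (p \<succ> x) = R (p \<triangleleft> x)\<close>.\<close>

lemma R_mult_succF:
  assumes "p \<in> Q" "x \<in> F"
  shows "R p \<otimes> sc p x = x \<otimes> R (Qp (p \<otimes> x))"
  using assms by (simp add: succF_eq m_assoc)

lemma R_mult_inv_succF:
  assumes "p \<in> Q" "x \<in> F"
  shows "R (Qp (p \<otimes> x)) \<otimes> inv (sc p x) = inv x \<otimes> R p"
  using assms by (simp add: succF_eq inv_mult_group m_assoc)

lemma succF_mult:
  assumes "p \<in> Q" "x \<in> F" "y \<in> F"
  shows "sc p (x \<otimes> y) = sc p x \<otimes> sc (Qp (p \<otimes> x)) y"
  using assms by (simp add: succF_eq m_assoc)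

lemma succF_one [simp]: "p \<in> Q \<Longrightarrow> sc p \<one> = \<one>"
  by (simp add: succF_eq)

text \<open>The product of \<open>p \<triangleleft> (R p \<triangleright> y)\<close> and
  \<open>R p \<triangleleft> y\<close> in \<open>Q\<close> is
  \<open>(p.R p) \<triangleleft> y\<close>, and \<open>F\<close> fixes the identity element.\<close>

lemma R_Qp_act:
  assumes "p \<in> Q" "y \<in> F"
  shows "R (Qp (p \<otimes> Fp (R p \<otimes> y))) = Qp (R p \<otimes> y)"
proof (rule R_eqI)
  have "Qp (Qp (p \<otimes> Fp (R p \<otimes> y)) \<otimes> Qp (R p \<otimes> y)) = Qp ((p \<otimes> R p) \<otimes> y)"
    using assms by (simp add: m_assoc del: parts_F_mult)
  also have "\<dots> = \<one>" using assms by (simp del: parts_F_mult)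
  finally show "Qp (p \<otimes> Fp (R p \<otimes> y)) \<otimes> Qp (R p \<otimes> y) \<in> F"
    using assms by (simp add: Qp_eq_one_iff del: Qp_Qp_mult)
qed (use assms in auto)

text \<open>Together with \<open>R_mult_succF\<close> this makes
  \<open>x \<mapsto> p \<succ> x\<close> inverse to
  \<open>y \<mapsto> R p \<triangleright> y\<close>. It identifies the antipode of the left factor
  in each term of the comultiplication of \<open>\<delta>\<^sub>e y\<close>.\<close>

lemma succF_act:
  assumes "p \<in> Q" "y \<in> F"
  shows "sc p (Fp (R p \<otimes> y)) = y"
  using assms by (simp add: succF_eq R_Qp_act m_assoc)

end

section \<open>Consequences of the cocycle identity\<close>

locale transversal_cocycle = group_transversal G F Q
  for G :: "('g, 'm) monoid_scheme" (structure) and F Q +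
  fixes \<omega> :: "'g \<Rightarrow> 'g \<Rightarrow> 'g \<Rightarrow> 'k::field"
  assumes cocycle: "normalized_3cocycle G \<omega>"
    and omega_F_left: "\<forall>x\<in>F. \<forall>a\<in>carrier G. \<forall>b\<in>carrier G. \<omega> x a b = 1"
    and omega_F_Q: "\<forall>a\<in>carrier G. \<forall>x\<in>F. \<forall>q\<in>Q. \<omega> a x q = 1"
begin

lemma omega_nz [simp]:
  "a \<in> carrier G \<Longrightarrow> b \<in> carrier G \<Longrightarrow> c \<in> carrier G \<Longrightarrow> \<omega> a b c \<noteq> 0"
  using cocycle by (auto simp: normalized_3cocycle_def)

lemma omega_one [simp]:
  "a \<in> carrier G \<Longrightarrow> b \<in> carrier G \<Longrightarrow> \<omega> \<one> a b = 1"
  "a \<in> carrier G \<Longrightarrow> b \<in> carrier G \<Longrightarrow> \<omega> a \<one> b = 1"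
  "a \<in> carrier G \<Longrightarrow> b \<in> carrier G \<Longrightarrow> \<omega> a b \<one> = 1"
  using cocycle by (auto simp: normalized_3cocycle_def)

lemma omega_cocycle:
  assumes "a \<in> carrier G" "b \<in> carrier G" "c \<in> carrier G" "d \<in> carrier G"
  shows "\<omega> (a \<otimes> b) c d * \<omega> a b (c \<otimes> d) = \<omega> a b c * \<omega> a (b \<otimes> c) d * \<omega> b c d"
  using cocycle assms by (auto simp: normalized_3cocycle_def)

lemma omega_F1 [simp]:
  "x \<in> F \<Longrightarrow> a \<in> carrier G \<Longrightarrow> b \<in> carrier G \<Longrightarrow> \<omega> x a b = 1"
  using omega_F_left by blast

lemma omega_FQ [simp]:
  "a \<in> carrier G \<Longrightarrow> x \<in> F \<Longrightarrow> q \<in> Q \<Longrightarrow> \<omega> a x q = 1"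
  using omega_F_Q by blast

text \<open>In the cocycle identity at \<open>(x, a, b, c)\<close> the three other factors have
  first argument \<open>x\<close> and equal 1. Hence \<open>\<omega>\<close> sees its first argument
  only modulo left multiplication by \<open>F\<close>.\<close>

lemma omega_F_mult [simp]:
  assumes "x \<in> F" "a \<in> carrier G" "b \<in> carrier G" "c \<in> carrier G"
  shows "\<omega> (x \<otimes> a) b c = \<omega> a b c"
  using omega_cocycle[of x a b c] assms by simp

lemma omega_Qp [simp]:
  assumes "a \<in> carrier G" "b \<in> carrier G" "c \<in> carrier G"
  shows "\<omega> (Qp a) b c = \<omega> a b c"
  using assms by (simp add: Qp_eq)

lemma omega_Fp_third:
  assumes "a \<in> carrier G" "x \<in> F" "g \<in> carrier G"
  shows "\<omega> a x (Fp g) = \<omega> a x g"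
  using omega_cocycle[of a x "Fp g" "Qp g"] assms by simp

text \<open>The two factors that disappear from the cocycle identity are
  \<open>\<omega> a (Fp g) (Qp g)\<close> and \<open>\<omega> (Fp g) (Qp g) d\<close>, both 1 by the
  normalization.\<close>

lemma omega_split_second:
  assumes "a \<in> carrier G" "g \<in> carrier G" "d \<in> carrier G"
  shows "\<omega> a g d = \<omega> (a \<otimes> Fp g) (Qp g) d * \<omega> a (Fp g) (Qp g \<otimes> d)"
  using omega_cocycle[of a "Fp g" "Qp g" d] assms by simp

lemma omega_split_third:
  assumes "a \<in> carrier G" "b \<in> carrier G" "g \<in> carrier G"
  shows "\<omega> a b g = \<omega> a b (Fp g) * \<omega> a (b \<otimes> Fp g) (Qp g)"
  using omega_cocycle[of a b "Fp g" "Qp g"] assms by simp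

text \<open>The compatibility of \<open>\<sigma>\<close> and \<open>\<tau>\<close> behind
  multiplicativity of the comultiplication: the cocycle identity at \<open>(s, t, x, y)\<close>,
  with the middle argument \<open>t \<otimes> x\<close> factored through \<open>Q\<close>.\<close>

lemma omega_comult:
  assumes "s \<in> Q" "t \<in> Q" "x \<in> F" "y \<in> F"
  shows "\<omega> (s \<otimes> t) x y * \<omega> s t (x \<otimes> y)
    = \<omega> s t x * \<omega> (s \<otimes> Fp (t \<otimes> x)) (Qp (t \<otimes> x)) y
      * (\<omega> s (Fp (t \<otimes> x)) (Fp (Qp (t \<otimes> x) \<otimes> y)) * \<omega> t x y)"
  using omega_cocycle[of s t x y] omega_split_second[of s "t \<otimes> x" y] assms
  by (simp add: omega_Fp_third mult_ac)

text \<open>The cocycle identity at \<open>(a, b, c, x)\<close> with all products factored. It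
  serves twice: with \<open>x\<close> in \<open>F\<close> for quasi-coassociativity and with
  \<open>x\<close> in \<open>Q\<close> for the pentagon.\<close>

lemma omega_four:
  assumes "a \<in> Q" "b \<in> Q" "c \<in> Q" "x \<in> carrier G"
  defines "b' \<equiv> Qp (b \<otimes> Fp (c \<otimes> x))" and "c' \<equiv> Qp (c \<otimes> x)"
  shows "\<omega> (a \<otimes> b) c x * \<omega> a b (Fp (c \<otimes> x))
      * \<omega> (a \<otimes> Fp (b \<otimes> Fp (c \<otimes> x))) b' c' * \<omega> a (Fp (b \<otimes> Fp (c \<otimes> x))) (Fp (b' \<otimes> c'))
    = \<omega> a b c * (\<omega> (a \<otimes> Fp (b \<otimes> c)) (Qp (b \<otimes> c)) x * \<omega> b c x)
      * \<omega> a (Fp (b \<otimes> c)) (Fp (Qp (b \<otimes> c) \<otimes> x))"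
proof -
  have "\<omega> a (b \<otimes> c) x = \<omega> (a \<otimes> Fp (b \<otimes> c)) (Qp (b \<otimes> c)) x * \<omega> a (Fp (b \<otimes> c)) (Fp (Qp (b \<otimes> c) \<otimes> x))"
    using omega_split_second[of a "b \<otimes> c" x] assms by (simp add: omega_Fp_third)
  moreover have "\<omega> a (b \<otimes> Fp (c \<otimes> x)) c'
      = \<omega> (a \<otimes> Fp (b \<otimes> Fp (c \<otimes> x))) b' c' * \<omega> a (Fp (b \<otimes> Fp (c \<otimes> x))) (Fp (b' \<otimes> c'))"
    using omega_split_second[of a "b \<otimes> Fp (c \<otimes> x)" c'] assms by (simp add: omega_Fp_third)
  moreover have "\<omega> a b (c \<otimes> x) = \<omega> a b (Fp (c \<otimes> x)) * \<omega> a (b \<otimes> Fp (c \<otimes> x)) c'"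
    using omega_split_third[of a b "c \<otimes> x"] assms by simp
  moreover have "\<omega> (a \<otimes> b) c x * \<omega> a b (c \<otimes> x) = \<omega> a b c * \<omega> a (b \<otimes> c) x * \<omega> b c x"
    using omega_cocycle[of a b c x] assms by simp
  ultimately show ?thesis
    by (simp add: mult_ac)
qed

section \<open>Cocycle identities for the antipode\<close>

definition antipode_coeff :: "'g \<Rightarrow> 'g \<Rightarrow> 'k" where
  "antipode_coeff p x = inverse (\<omega> p (R p) (sc p x)) * inverse (\<omega> (R p) (sc p x) (inv (sc p x)))"

lemma antipode_coeff_nz: "p \<in> Q \<Longrightarrow> x \<in> F \<Longrightarrow> antipode_coeff p x \<noteq> 0"
  by (simp add: antipode_coeff_def)

lemma antipode_coeff_one [simp]: "p \<in> Q \<Longrightarrow> antipode_coeff p \<one> = 1"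
  by (simp add: antipode_coeff_def)

text \<open>In the cocycle identity at \<open>(q, inv q, q, inv q)\<close> every other factor
  contains the identity element. This reconciles the two formulas for
  \<open>\<beta>\<close>.\<close>

lemma omega_inverse:
  assumes "q \<in> carrier G"
  shows "\<omega> (inv q) q (inv q) = inverse (\<omega> q (inv q) q)"
  using omega_cocycle[of q "inv q" q "inv q"] assms by (simp add: field_simps)

lemma antipode_coeff_act:
  assumes "s \<in> Q" "x \<in> F"
  shows "antipode_coeff s (Fp (R s \<otimes> x)) = inverse (\<omega> s (R s) x) * inverse (\<omega> (R s) x (inv x))"
  using assms by (simp add: antipode_coeff_def succF_act)

text \<open>The scalar part of antimultiplicativity of the antipode; the last factor on the right is
  the coefficient of the product of the two inverse arrows.\<close>

lemma antipode_coeff_mult: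
  assumes p: "p \<in> Q" and x: "x \<in> F" "x' \<in> F"
  defines "p' \<equiv> Qp (p \<otimes> x)"
  shows "\<omega> p x x' * antipode_coeff p (x \<otimes> x')
    = antipode_coeff p' x' * antipode_coeff p x * \<omega> (R (Qp (p' \<otimes> x'))) (inv (sc p' x')) (inv (sc p x))"
proof -
  define q q' q'' y y' where defs: "q = R p" "q' = R p'" "q'' = R (Qp (p' \<otimes> x'))"
    "y = sc p x" "y' = sc p' x'"
  have p': "p' \<in> Q" using assms by simp
  have cl [simp]: "q \<in> Q" "q' \<in> Q" "q'' \<in> Q" "y \<in> F" "y' \<in> F" "p \<in> Q" "x \<in> F" "x' \<in> F" "p' \<in> Q"
    using assms p' by (simp_all add: defs)
  have qy: "q \<otimes> y = x \<otimes> q'" and qy': "q' \<otimes> y' = x' \<otimes> q''"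
    unfolding defs using R_mult_succF[OF p x(1)] R_mult_succF[OF p' x(2)] by (simp_all add: p'_def)
  have qyy: "q \<otimes> (y \<otimes> y') = x \<otimes> x' \<otimes> q''"
  proof -
    have "q \<otimes> (y \<otimes> y') = (q \<otimes> y) \<otimes> y'" by (simp add: m_assoc)
    also have "\<dots> = x \<otimes> (q' \<otimes> y')" by (simp add: qy m_assoc)
    finally show ?thesis by (simp add: qy' m_assoc)
  qed
  have pq: "p \<otimes> q \<in> F" using p by (simp add: defs)
  have px: "\<omega> (p \<otimes> x) a b = \<omega> p' a b" if "a \<in> carrier G" "b \<in> carrier G" for a b
    using that by (simp add: p'_def)
  \<comment> \<open>Multiplicativity of the comultiplication at the term \<open>(p, q)\<close>; the
    factor \<open>\<omega> (p \<otimes> q) y y'\<close> is 1 because \<open>p \<otimes> q\<close>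
    lies in \<open>F\<close>.\<close>
  have E1: "\<omega> p q (y \<otimes> y') = \<omega> p q y * \<omega> p' q' y' * (\<omega> p x x' * \<omega> q y y')"
    using omega_comult[of p q y y'] pq px[of q' y'] by (simp add: qy qy')
  \<comment> \<open>\<open>E2\<close> and \<open>E3\<close> compare the normalization of the inverse
    of \<open>y \<otimes> y'\<close> with those of the inverses of \<open>y\<close> and
    \<open>y'\<close>.\<close>
  have E2: "\<omega> q'' (inv y') (inv y) * \<omega> q (y \<otimes> y') (inv y' \<otimes> inv y)
      = \<omega> q (y \<otimes> y') (inv y') * \<omega> q y (inv y)"
    using omega_cocycle[of q "y \<otimes> y'" "inv y'" "inv y"] by (simp add: qyy m_assoc)
  have E3: "\<omega> q' y' (inv y') = \<omega> q y y' * \<omega> q (y \<otimes> y') (inv y')"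
    using omega_cocycle[of q y y' "inv y'"] by (simp add: qy)
  have sc: "sc p (x \<otimes> x') = y \<otimes> y'"
    unfolding defs using succF_mult[OF p x] by (simp add: p'_def)
  have E2': "\<omega> q (y \<otimes> y') (inv y')
      = \<omega> q'' (inv y') (inv y) * \<omega> q (y \<otimes> y') (inv y' \<otimes> inv y) / \<omega> q y (inv y)"
    using E2 by (simp add: field_simps)
  show ?thesis
    unfolding antipode_coeff_def sc defs(1-5)[symmetric]
    by (simp add: inv_mult_group E1 E3 E2' field_simps)
qed

text \<open>With \<open>q = R t\<close> and \<open>s = t \<otimes> q\<close> in \<open>F\<close>,
  the element \<open>inv q = inv s \<otimes> t\<close> lies in the coset of \<open>t\<close>, so the
  left side is \<open>\<omega> t q (inv q)\<close>. The cocycle identity at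
  \<open>(t, q, inv s, t)\<close> then splits it.\<close>

lemma omega_beta_eq:
  assumes "t \<in> Q"
  shows "\<omega> (inv (R t)) (R t) (inv (R t)) = \<omega> t (R t) (inv (t \<otimes> R t)) * \<omega> t (inv t) t"
proof -
  define q where "q = R t"
  have [simp]: "t \<in> Q" "q \<in> Q" "t \<otimes> q \<in> F" using assms by (auto simp: q_def)
  have 1: "q \<otimes> inv (t \<otimes> q) = inv t" "inv (t \<otimes> q) \<otimes> t = inv q"
    by (simp_all add: inv_mult_group m_assoc)
  have 2: "\<omega> (inv q) q (inv q) = \<omega> t q (inv q)"
    using omega_F_mult[of "inv (t \<otimes> q)" t q "inv q"] 1 by simp
  show ?thesis
    using omega_cocycle[of t q "inv (t \<otimes> q)" t] 1 2 by (simp flip: q_def)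
qed

text \<open>The scalar part of the \<open>\<beta>\<close> axiom. The factors on the left come, in
  order, from the comultiplication, the antipode, \<open>\<beta>\<close>, and the two products; the
  right side is the coefficient of \<open>\<beta>\<close> at \<open>R t'\<close>.\<close>

lemma omega_beta:
  assumes t: "t \<in> Q" and x: "x \<in> F"
  defines "t' \<equiv> Qp (t \<otimes> x)" and "y \<equiv> sc t x"
  shows "\<omega> (L t) t x * antipode_coeff t x * \<omega> (inv (R t)) (R t) (inv (R t))
      * \<omega> (R t') (inv y) (inv (t \<otimes> R t)) * \<omega> (R t') (inv y \<otimes> inv (t \<otimes> R t)) (Fp (t \<otimes> x))
    = \<omega> (inv (R t')) (R t') (inv (R t'))"
proof -
  define q q' s s' X where defs: "q = R t" "q' = R t'" "s = t \<otimes> R t" "s' = t' \<otimes> R t'" "X = Fp (t \<otimes> x)"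
  have t': "t' \<in> Q" using assms by simp
  have cl [simp]: "q \<in> Q" "q' \<in> Q" "s \<in> F" "s' \<in> F" "X \<in> F" "y \<in> F" "t \<in> Q" "x \<in> F" "t' \<in> Q"
    using assms t' by (simp_all add: defs)
  have tq: "t \<otimes> q = s" "t' \<otimes> q' = s'" by (simp_all add: defs)
  have tx: "t \<otimes> x = X \<otimes> t'" using t x by (simp add: defs t'_def)
  have qy: "q \<otimes> y = x \<otimes> q'"
    unfolding defs y_def using R_mult_succF[OF t x] by (simp add: t'_def)
  have qs: "q \<otimes> inv s = inv t" "q' \<otimes> inv s' = inv t'"
    unfolding tq[symmetric] by (simp_all add: inv_mult_group m_assoc)
  have tX: "inv t \<otimes> X = x \<otimes> inv t'"
  proof -
    have "X = t \<otimes> x \<otimes> inv t'" by (simp add: tx m_assoc)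
    then show ?thesis by (simp add: m_assoc)
  qed
  have q'y: "q' \<otimes> inv y = inv x \<otimes> q"
    unfolding defs y_def using R_mult_inv_succF[OF t x] by (simp add: t'_def)
  have sX: "inv s \<otimes> X = y \<otimes> inv s'"
  proof -
    have "q \<otimes> (inv s \<otimes> X) = inv t \<otimes> X" by (simp add: qs flip: m_assoc)
    also have "\<dots> = x \<otimes> (q' \<otimes> inv s')" by (simp add: tX qs)
    also have "\<dots> = q \<otimes> (y \<otimes> inv s')" by (simp add: qy flip: m_assoc)
    finally show ?thesis by simp
  qed
  have wtx: "\<omega> (t \<otimes> x) a b = \<omega> t' a b" if "a \<in> carrier G" "b \<in> carrier G" for a b
    using that by (simp add: tx)
  have b: "\<omega> (inv q) q (inv q) = \<omega> t q (inv s) * \<omega> t (inv t) t"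
    "\<omega> (inv q') q' (inv q') = \<omega> t' q' (inv s') * \<omega> t' (inv t') t'"
    unfolding defs by (rule omega_beta_eq, simp)+
  \<comment> \<open>\<open>A1\<close> and \<open>A2\<close> trade the scalars of the two products
    for factors based at \<open>q\<close>; their common factor is later called
    \<open>?U\<close>.\<close>
  have A1: "\<omega> q' (inv y) (inv s) * \<omega> q' (inv y \<otimes> inv s) X = \<omega> q (inv s) X * \<omega> q' (inv y) (y \<otimes> inv s')"
    using omega_cocycle[of q' "inv y" "inv s" X] by (simp add: q'y sX)
  have A2: "\<omega> q y (inv s') * \<omega> q' (inv y) (y \<otimes> inv s') = \<omega> q y (inv y)"
    using omega_cocycle[of q' "inv y" y "inv s'"] omega_cocycle[of q y "inv y" y]
    by (simp add: q'y qy)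
  \<comment> \<open>The remaining identities evaluate two quantities twice:
    \<open>\<omega> t q (y \<otimes> inv s')\<close> in \<open>M1\<close> and \<open>M4\<close>,
    since \<open>inv s \<otimes> X = y \<otimes> inv s'\<close>, and
    \<open>\<omega> t (inv t) (t \<otimes> x)\<close> in \<open>M5\<close> and
    \<open>M6\<close>.\<close>
  have M1: "\<omega> t q (y \<otimes> inv s') = \<omega> t q y * \<omega> t (x \<otimes> q') (inv s') * \<omega> q y (inv s')"
    using omega_cocycle[of t q y "inv s'"] by (simp add: tq qy)
  have M2: "\<omega> t (x \<otimes> q') (inv s') = \<omega> t' q' (inv s') * \<omega> t x (inv t')"
    using omega_split_second[of t "x \<otimes> q'" "inv s'"] wtx by (simp add: qs)
  have M4: "\<omega> t q (y \<otimes> inv s') = \<omega> t q (inv s) * \<omega> t (inv t) X * \<omega> q (inv s) X"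
    using omega_cocycle[of t q "inv s" X] by (simp add: tq qs sX)
  have M5: "\<omega> t (inv t) (t \<otimes> x) = \<omega> t (inv t) t * \<omega> (inv t) t x"
    using omega_cocycle[of t "inv t" t x] by simp
  have M6: "\<omega> t (inv t) (t \<otimes> x) = \<omega> t (inv t) X * \<omega> t (x \<otimes> inv t') t'"
    using omega_split_third[of t "inv t" "t \<otimes> x"] by (simp add: tX tx)
  have M7: "\<omega> t' (inv t') t' = \<omega> t x (inv t') * \<omega> t (x \<otimes> inv t') t'"
    using omega_cocycle[of t x "inv t'" t'] wtx by simp
  have wL: "\<omega> (L t) t x = \<omega> (inv t) t x"
    by (simp add: L_eq)
  let ?U = "\<omega> q' (inv y) (y \<otimes> inv s')"
  have *: "\<omega> t q (inv s) * \<omega> t (inv t) X * \<omega> q (inv s) X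
      = \<omega> t q y * (\<omega> t' q' (inv s') * \<omega> t x (inv t')) * \<omega> q y (inv s')"
    using M1 M2 M4 by simp
  have **: "\<omega> t (inv t) t * \<omega> (inv t) t x = \<omega> t (inv t) X * \<omega> t (x \<otimes> inv t') t'"
    using M5 M6 by simp
  \<comment> \<open>The extra factor \<open>\<omega> t (inv t) X\<close> links the two double
    evaluations. It is nonzero and cancels when \<open>main\<close> is extracted.\<close>
  have "(\<omega> (inv t) t x * (\<omega> t q (inv s) * \<omega> t (inv t) t) * (\<omega> q (inv s) X * ?U)) * \<omega> t (inv t) X
    = (\<omega> t (inv t) t * \<omega> (inv t) t x) * (\<omega> t q (inv s) * \<omega> t (inv t) X * \<omega> q (inv s) X) * ?U"
    by (simp add: mult_ac)
  also have "\<dots> = (\<omega> t' q' (inv s') * (\<omega> t x (inv t') * \<omega> t (x \<otimes> inv t') t')) * \<omega> t q y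
      * (\<omega> q y (inv s') * ?U) * \<omega> t (inv t) X"
    unfolding * ** by (simp add: mult_ac)
  finally have main: "\<omega> (inv t) t x * (\<omega> t q (inv s) * \<omega> t (inv t) t) * (\<omega> q (inv s) X * ?U)
      = (\<omega> t' q' (inv s') * \<omega> t' (inv t') t') * \<omega> t q y * \<omega> q y (inv y)"
    unfolding A2 M7[symmetric] by simp
  have "\<omega> (L t) t x * antipode_coeff t x * \<omega> (inv q) q (inv q) * \<omega> q' (inv y) (inv s) * \<omega> q' (inv y \<otimes> inv s) X
    = (\<omega> (inv t) t x * (\<omega> t q (inv s) * \<omega> t (inv t) t) * (\<omega> q (inv s) X * ?U))
      * inverse (\<omega> t q y) * inverse (\<omega> q y (inv y))"
    unfolding A1[symmetric] b wL antipode_coeff_def y_def[symmetric] defs(1)[symmetric] by (simp add: mult_ac)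
  also have "\<dots> = \<omega> (inv q') q' (inv q')"
    unfolding main b by (simp add: field_simps)
  finally show ?thesis
    unfolding defs .
qed

text \<open>The cocycle identity at \<open>(inv q, s, inv r, r)\<close>, with \<open>r = R q\<close>
  and \<open>s = q \<otimes> r\<close> in \<open>F\<close>, expresses
  \<open>\<omega> r (inv r) r\<close> by the other two factors; \<open>omega_inverse\<close> inverts
  it.\<close>

lemma omega_antipode_assoc:
  assumes "q \<in> Q"
  shows "\<omega> (L q) q (R q) * \<omega> (inv (R q)) (R q) (inv (R q))
    * \<omega> (R q) (inv (q \<otimes> R q)) (q \<otimes> R q) = 1"
proof -
  define r s where defs: "r = R q" "s = q \<otimes> R q"
  have [simp]: "q \<in> Q" "r \<in> Q" "s \<in> F" using assms by (simp_all add: defs)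
  have qs: "q \<otimes> r = s" "inv q = r \<otimes> inv s" "s \<otimes> inv r = q"
    by (simp_all add: defs inv_mult_group m_assoc assms)
  have "\<omega> r (inv r) r = \<omega> (r \<otimes> inv s) s (inv r) * \<omega> (r \<otimes> inv s) q r"
    using omega_cocycle[of "r \<otimes> inv s" s "inv r" r] by (simp add: qs m_assoc)
  moreover have "\<omega> (r \<otimes> inv s) s (inv r) = \<omega> r (inv s) s"
    using omega_cocycle[of r "inv s" s "inv r"] by (simp add: qs)
  moreover have "\<omega> (L q) q r = \<omega> (r \<otimes> inv s) q r"
    by (simp add: L_eq qs)
  ultimately show ?thesis
    unfolding defs(1)[symmetric] qs(1) by (simp add: omega_inverse field_simps)
qed

text \<open>The counterpart for the inverse associator: \<open>omega_beta_eq\<close> removes the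
  factor with \<open>R r\<close>, and the cocycle identity at \<open>(inv q, f, inv r, r)\<close>
  supplies \<open>\<omega> r (inv r) r\<close>.\<close>

lemma omega_antipode_assoc_inv:
  assumes "r \<in> Q"
  defines "q \<equiv> L r" and "f \<equiv> L r \<otimes> r"
  shows "\<omega> (L q) q r * \<omega> (L q) f (inv f) * \<omega> r (R r) (inv (r \<otimes> R r))
    = \<omega> (inv (R r)) (R r) (inv (R r))"
proof -
  have [simp]: "q \<in> Q" "r \<in> Q" "f \<in> F" using assms by simp_all
  have qf: "inv q = r \<otimes> inv f" "f \<otimes> inv r = q" "inv r = inv f \<otimes> q"
    by (simp_all add: q_def f_def inv_mult_group m_assoc assms)
  have "\<omega> r (inv r) r = \<omega> (r \<otimes> inv f) f (inv r) * \<omega> (r \<otimes> inv f) q r"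
    using omega_cocycle[of "r \<otimes> inv f" f "inv r" r] by (simp add: qf(2) m_assoc)
  moreover have "\<omega> (r \<otimes> inv f) f (inv r) = \<omega> (r \<otimes> inv f) f (inv f)"
    using omega_Fp_third[of "r \<otimes> inv f" f "inv r"] by (simp add: qf(3))
  moreover have "\<omega> (L q) a b = \<omega> (r \<otimes> inv f) a b" if "a \<in> carrier G" "b \<in> carrier G" for a b
    using that L_eq[of q] by (simp add: qf(1))
  ultimately show ?thesis
    by (simp add: omega_beta_eq)
qed

section \<open>The quasi-bialgebra\<close>

abbreviation A where "A \<equiv> smash_alg G F Q \<omega>"
abbreviation \<Delta> where "\<Delta> \<equiv> smash_comult G F Q \<omega>"
abbreviation \<Phi> where "\<Phi> \<equiv> smash_associator G F Q \<omega>"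

definition smash_coeff :: "'g \<times> 'g \<Rightarrow> 'g \<times> 'g \<Rightarrow> 'k" where
  "smash_coeff = (\<lambda>(p, x) (q, y). if Qp (p \<otimes> x) = q then \<omega> p x y else 0)"

text \<open>Defined even for arrows that do not compose, so that associativity of indices is
  unconditional; such products vanish through \<open>smash_coeff\<close>.\<close>

definition smash_index :: "'g \<times> 'g \<Rightarrow> 'g \<times> 'g \<Rightarrow> 'g \<times> 'g" where
  "smash_index = (\<lambda>(p, x) (q, y). (p, x \<otimes> y))"

lemma smash_coeff_simp [simp]: "smash_coeff (p, x) (q, y) = (if Qp (p \<otimes> x) = q then \<omega> p x y else 0)"
  by (simp add: smash_coeff_def)

lemma smash_index_simp [simp]: "smash_index (p, x) (q, y) = (p, x \<otimes> y)"
  by (simp add: smash_index_def)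

lemma ixs_A [simp]: "ixs A = Q \<times> F"
  by (simp add: smash_alg_def)

lemma one_A: "\<one>\<^bsub>A\<^esub> = lincomb Q (\<lambda>_. 1) (\<lambda>p. (p, \<one>))"
  by (simp add: smash_alg_def lincomb_def)

lemma monomial_A: "monomial_algebra A smash_coeff smash_index"
proof -
  interpret monomial_mult A smash_coeff smash_index
  proof
    show "monoid.mult A = (\<lambda>v w d. \<Sum>a\<in>ixs A. \<Sum>b\<in>ixs A. v a * w b * (smash_coeff a b * bv (smash_index a b) d))"
      by (auto simp: smash_alg_def smash_coeff_def smash_index_def actQ_def sigma_def case_prod_unfold intro!: ext sum.cong)
    fix a b d assume "a \<in> ixs A" "b \<in> ixs A" "d \<in> ixs A"
    then obtain p x q y r z where *: "a = (p, x)" "b = (q, y)" "d = (r, z)"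
      "p \<in> Q" "x \<in> F" "q \<in> Q" "y \<in> F" "r \<in> Q" "z \<in> F"
      by auto
    show "smash_coeff a b * smash_coeff (smash_index a b) d = smash_coeff b d * smash_coeff a (smash_index b d)"
      \<comment> \<open>The factor \<open>\<omega> x y z\<close> is 1 because \<open>x\<close> lies
        in \<open>F\<close>, so the 3-cocycle identity becomes the 2-cocycle condition for
        \<open>\<sigma>\<close>.\<close>
      using * omega_cocycle[of p x y z] omega_Qp[of "p \<otimes> x" y z]
      by (auto simp: m_assoc mult_ac simp del: omega_Qp)
  qed (auto simp: smash_alg_def m_assoc)
  show ?thesis
  proof
    show "\<one>\<^bsub>A\<^esub> \<in> vec_on (ixs A)"
      unfolding one_A by (rule lincomb_closed) auto
    fix a assume a: "a \<in> ixs A"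
    \<comment> \<open>Exactly one identity arrow composes with \<open>a\<close> on each side: the
      one at its source on the left, the one at its target on the right.\<close>
    have "lincomb Q (\<lambda>_. 1) (\<lambda>p. (p, \<one>)) \<otimes>\<^bsub>A\<^esub> lincomb {()} (\<lambda>_. 1) (\<lambda>_. a)
        = lincomb {()} (\<lambda>_. 1) (\<lambda>_. a)"
      using a by (subst lincomb_mult[where P = "{()}" and f = "\<lambda>_. fst a" and g = "\<lambda>_. ()"])
        (auto split: if_splits intro!: lincomb_cong)
    then show "\<one>\<^bsub>A\<^esub> \<otimes>\<^bsub>A\<^esub> bv a = bv a"
      unfolding one_A by (simp flip: bv_eq_lincomb)
    have "lincomb {()} (\<lambda>_. 1) (\<lambda>_. a) \<otimes>\<^bsub>A\<^esub> lincomb Q (\<lambda>_. 1) (\<lambda>p. (p, \<one>))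
        = lincomb {()} (\<lambda>_. 1) (\<lambda>_. a)"
      using a by (subst lincomb_mult[where P = "{()}" and g = "\<lambda>_. Qp (fst a \<otimes> snd a)" and f = "\<lambda>_. ()"])
        (auto split: if_splits intro!: lincomb_cong)
    then show "bv a \<otimes>\<^bsub>A\<^esub> \<one>\<^bsub>A\<^esub> = bv a"
      unfolding one_A by (simp flip: bv_eq_lincomb)
  qed
qed

sublocale A: monomial_algebra A smash_coeff smash_index
  by (rule monomial_A)

text \<open>Naming the interpretations makes \<open>lincomb_mult\<close> available in each tensor
  power, where a product is computed by listing the composable pairs of arrow tuples.\<close>

sublocale A2: monomial_algebra "tensor_sq A" "\<lambda>(a, b) (a', b'). smash_coeff a a' * smash_coeff b b'"
  "\<lambda>(a, b) (a', b'). (smash_index a a', smash_index b b')"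
  by (intro monomial_algebra_tensor monomial_A)

sublocale A3: monomial_algebra "tensor_cube A"
  "\<lambda>(a, b) (a', b'). smash_coeff a a' * (case b of (b, d) \<Rightarrow> \<lambda>(b', d'). smash_coeff b b' * smash_coeff d d') b'"
  "\<lambda>(a, b) (a', b'). (smash_index a a', (case b of (b, d) \<Rightarrow> \<lambda>(b', d'). (smash_index b b', smash_index d d')) b')"
  by (intro monomial_algebra_tensor monomial_A)

sublocale A4: monomial_algebra "tensor_fourth A"
  "\<lambda>(a, b) (a', b'). smash_coeff a a' * (case b of (a, b) \<Rightarrow> \<lambda>(a', b').
     smash_coeff a a' * (case b of (b, d) \<Rightarrow> \<lambda>(b', d'). smash_coeff b b' * smash_coeff d d') b') b'"
  "\<lambda>(a, b) (a', b'). (smash_index a a', (case b of (a, b) \<Rightarrow> \<lambda>(a', b').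
     (smash_index a a', (case b of (b, d) \<Rightarrow> \<lambda>(b', d'). (smash_index b b', smash_index d d')) b')) b')"
  by (intro monomial_algebra_tensor monomial_A)

section \<open>The comultiplication\<close>

definition factors :: "'g \<Rightarrow> ('g \<times> 'g) set" where
  "factors p = {(s, t). s \<in> Q \<and> t \<in> Q \<and> Qp (s \<otimes> t) = p}"

lemma finite_factors [simp]: "finite (factors p)"
  by (rule finite_subset[of _ "Q \<times> Q"]) (auto simp: factors_def)

lemma comult_eq_sum:
  "\<Delta> v d = (\<Sum>(p, x)\<in>Q \<times> F. v (p, x) *
    lincomb (factors p) (\<lambda>(s, t). \<omega> s t x) (\<lambda>(s, t). ((s, Fp (t \<otimes> x)), (t, x))) d)"
  by (auto simp: smash_comult_def lincomb_def factors_def dotQ_def actF_def tau_def tensor_bv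
      intro!: sum.cong)

lemma comult_lincomb:
  assumes "\<phi> ` N \<subseteq> Q \<times> F" "finite N"
  shows "\<Delta> (lincomb N \<gamma> \<phi>) = lincomb (SIGMA n:N. factors (fst (\<phi> n)))
    (\<lambda>(n, s, t). \<gamma> n * \<omega> s t (snd (\<phi> n)))
    (\<lambda>(n, s, t). ((s, Fp (t \<otimes> snd (\<phi> n))), (t, snd (\<phi> n))))"
proof -
  have "\<Delta> (lincomb N \<gamma> \<phi>) = (\<lambda>d. \<Sum>n\<in>N. \<gamma> n * lincomb (factors (fst (\<phi> n)))
      (\<lambda>(s, t). \<omega> s t (snd (\<phi> n))) (\<lambda>(s, t). ((s, Fp (t \<otimes> snd (\<phi> n))), (t, snd (\<phi> n)))) d)"
    unfolding comult_eq_sum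
    by (rule ext, rule sum2_lincomb) (use assms in auto)
  also have "\<dots> = lincomb (SIGMA n:N. factors (fst (\<phi> n)))
    (\<lambda>(n, s, t). \<gamma> n * \<omega> s t (snd (\<phi> n)))
    (\<lambda>(n, s, t). ((s, Fp (t \<otimes> snd (\<phi> n))), (t, snd (\<phi> n))))"
    using assms by (subst sum_lincomb_SIGMA) (auto simp: case_prod_unfold)
  finally show ?thesis .
qed

lemma comult_bv:
  assumes "p \<in> Q" "x \<in> F"
  shows "\<Delta> (bv (p, x)) = lincomb (factors p) (\<lambda>(s, t). \<omega> s t x) (\<lambda>(s, t). ((s, Fp (t \<otimes> x)), (t, x)))"
  unfolding bv_eq_lincomb
  by (subst comult_lincomb)
    (use assms in \<open>auto intro!: lincomb_bij_witness[where i = "\<lambda>st. ((), st)" and j = snd]\<close>)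

text \<open>Indexing by \<open>(s, t, x)\<close> recovers the source as \<open>s.t\<close> and
  replaces the dependent sum over factorizations by a plain product of sets.\<close>

lemma comult_eq:
  assumes "v \<in> vec_on (Q \<times> F)"
  shows "\<Delta> v = lincomb (Q \<times> Q \<times> F) (\<lambda>(s, t, x). v (Qp (s \<otimes> t), x) * \<omega> s t x)
    (\<lambda>(s, t, x). ((s, Fp (t \<otimes> x)), (t, x)))"
proof -
  have "\<Delta> v = \<Delta> (lincomb (Q \<times> F) v (\<lambda>b. b))"
    using vec_eq_lincomb[OF _ assms] by simp
  also have "\<dots> = lincomb (Q \<times> Q \<times> F) (\<lambda>(s, t, x). v (Qp (s \<otimes> t), x) * \<omega> s t x)
    (\<lambda>(s, t, x). ((s, Fp (t \<otimes> x)), (t, x)))"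
    by (subst comult_lincomb)
      (auto simp: factors_def intro!: lincomb_bij_witness[where
        i = "\<lambda>(s, t, x). ((Qp (s \<otimes> t), x), (s, t))" and j = "\<lambda>((p, x), (s, t)). (s, t, x)"])
  finally show ?thesis .
qed

lemma mult_A_eq:
  assumes "v \<in> vec_on (Q \<times> F)" "w \<in> vec_on (Q \<times> F)"
  shows "v \<otimes>\<^bsub>A\<^esub> w = lincomb (Q \<times> F \<times> F) (\<lambda>(p, x, y). v (p, x) * w (Qp (p \<otimes> x), y) * \<omega> p x y)
    (\<lambda>(p, x, y). (p, x \<otimes> y))"
proof -
  have "lincomb (Q \<times> F) v (\<lambda>b. b) \<otimes>\<^bsub>A\<^esub> lincomb (Q \<times> F) w (\<lambda>b. b)
    = lincomb (Q \<times> F \<times> F) (\<lambda>(p, x, y). v (p, x) * w (Qp (p \<otimes> x), y) * \<omega> p x y)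
    (\<lambda>(p, x, y). (p, x \<otimes> y))"
    by (subst A.lincomb_mult[where P = "Q \<times> F \<times> F" and f = "\<lambda>(p, x, y). (p, x)"
          and g = "\<lambda>(p, x, y). (Qp (p \<otimes> x), y)"])
      (auto simp: inj_on_def split: if_splits intro!: lincomb_cong)
  then show ?thesis
    using vec_eq_lincomb[OF _ assms(1)] vec_eq_lincomb[OF _ assms(2)] by simp
qed

lemma comult_mult:
  assumes "v \<in> vec_on (Q \<times> F)" "w \<in> vec_on (Q \<times> F)"
  shows "\<Delta> (v \<otimes>\<^bsub>A\<^esub> w) = \<Delta> v \<otimes>\<^bsub>tensor_sq A\<^esub> \<Delta> w"
proof -
  let ?r = "lincomb (Q \<times> Q \<times> F \<times> F)
    (\<lambda>(s, t, x, y). v (Qp (s \<otimes> t), x) * w (Qp (s \<otimes> t \<otimes> x), y) * (\<omega> (s \<otimes> t) x y * \<omega> s t (x \<otimes> y)))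
    (\<lambda>(s, t, x, y). ((s, Fp (t \<otimes> (x \<otimes> y))), (t, x \<otimes> y)))"
  have "\<Delta> (v \<otimes>\<^bsub>A\<^esub> w) = ?r"
    unfolding mult_A_eq[OF assms]
    by (subst comult_lincomb)
      (auto simp: factors_def m_assoc intro!: lincomb_bij_witness[where
        i = "\<lambda>(s, t, x, y). ((Qp (s \<otimes> t), x, y), (s, t))" and j = "\<lambda>((p, x, y), (s, t)). (s, t, x, y)"])
  also have "?r = \<Delta> v \<otimes>\<^bsub>tensor_sq A\<^esub> \<Delta> w"
    unfolding comult_eq[OF assms(1)] comult_eq[OF assms(2)]
    \<comment> \<open>A term \<open>(s, t, x)\<close> composes in both slots exactly with the terms
      starting at \<open>s \<triangleleft> (t \<triangleright> x)\<close> and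
      \<open>t \<triangleleft> x\<close>, which is the choice of \<open>g\<close>.\<close>
    by (subst A2.lincomb_mult[where P = "Q \<times> Q \<times> F \<times> F" and f = "\<lambda>(s, t, x, y). (s, t, x)"
          and g = "\<lambda>(s, t, x, y). (Qp (s \<otimes> Fp (t \<otimes> x)), Qp (t \<otimes> x), y)"])
      (auto simp: inj_on_def omega_comult m_assoc split: if_splits intro!: lincomb_cong)
  finally show ?thesis .
qed

lemma comult_one: "\<Delta> \<one>\<^bsub>A\<^esub> = \<one>\<^bsub>tensor_sq A\<^esub>"
  unfolding one_tensor one_A tensor_lincomb
  by (subst comult_lincomb)
    (auto simp: factors_def intro!: lincomb_bij_witness[where
        i = "\<lambda>(s, t). (Qp (s \<otimes> t), (s, t))" and j = snd])

lemma comult_linear: "linear_map_on (Q \<times> F) ((Q \<times> F) \<times> (Q \<times> F)) \<Delta>"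
  unfolding linear_map_on_def
proof (intro conjI ballI allI)
  fix v :: "'g \<times> 'g \<Rightarrow> 'k" assume v: "v \<in> vec_on (Q \<times> F)"
  show "\<Delta> v \<in> vec_on ((Q \<times> F) \<times> (Q \<times> F))"
    unfolding comult_eq[OF v] by (rule lincomb_closed) auto
  show "\<Delta> (vadd v w) = vadd (\<Delta> v) (\<Delta> w)" for w
    by (rule ext) (simp add: comult_eq_sum vadd_def distrib_right sum.distrib case_prod_unfold)
  show "\<Delta> (scale c v) = scale c (\<Delta> v)" for c
    by (rule ext) (simp add: comult_eq_sum scale_def sum_distrib_left mult.assoc case_prod_unfold)
qed

section \<open>The counit\<close>

lemma counit_eq: "smash_counit G F Q v = (\<Sum>x\<in>F. v (\<one>, x))"
proof -
  have "smash_counit G F Q v = (\<Sum>x\<in>F. \<Sum>p\<in>Q. if p = \<one> then v (p, x) else 0)"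
    unfolding smash_counit_def
    by (subst sum.swap) (simp add: sum.cartesian_product case_prod_unfold if_distrib cong: if_cong)
  then show ?thesis by simp
qed

lemma counit_lincomb:
  assumes "finite N" "\<phi> ` N \<subseteq> Q \<times> F"
  shows "smash_counit G F Q (lincomb N \<gamma> \<phi>) = (\<Sum>n\<in>N. \<gamma> n * (if fst (\<phi> n) = \<one> then 1 else 0))"
  unfolding smash_counit_def using sum2_lincomb[of Q F \<phi> N \<gamma> "\<lambda>p x. if p = \<one> then 1 else 0"] assms
  by simp

lemma counit_bv: "p \<in> Q \<Longrightarrow> x \<in> F \<Longrightarrow> smash_counit G F Q (bv (p, x)) = (if p = \<one> then 1 else 0 :: 'k)"
  by (auto simp: counit_eq bv_def)

lemma counit_linear: "linear_form_on (Q \<times> F) (smash_counit G F Q :: _ \<Rightarrow> 'k)"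
  by (auto simp: linear_form_on_def counit_eq vadd_def scale_def sum.distrib sum_distrib_left)

lemma counit_mult:
  assumes "v \<in> vec_on (Q \<times> F)" "w \<in> vec_on (Q \<times> F)"
  shows "smash_counit G F Q (v \<otimes>\<^bsub>A\<^esub> w) = smash_counit G F Q v * smash_counit G F Q w"
proof -
  have "smash_counit G F Q (v \<otimes>\<^bsub>A\<^esub> w) = (\<Sum>(p, x, y)\<in>Q \<times> F \<times> F.
      if p = \<one> then v (\<one>, x) * w (\<one>, y) else 0)"
    unfolding mult_A_eq[OF assms]
    by (subst counit_lincomb) (auto intro!: sum.cong)
  also have "\<dots> = (\<Sum>p\<in>Q. if p = \<one> then (\<Sum>(x, y)\<in>F \<times> F. v (\<one>, x) * w (\<one>, y)) else 0)"
    unfolding sum.cartesian_product'[of _ Q] by (intro sum.cong refl) (simp add: case_prod_unfold)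
  finally show ?thesis
    by (simp add: counit_eq sum_product sum.cartesian_product)
qed

lemma counit_one: "smash_counit G F Q \<one>\<^bsub>A\<^esub> = 1"
  unfolding one_A by (subst counit_lincomb) auto

section \<open>The associator and its inverse\<close>

lemma associator_eq: "\<Phi> = lincomb (Q \<times> Q \<times> Q) (\<lambda>(p, q, r). \<omega> p q r)
    (\<lambda>(p, q, r). ((p, Fp (q \<otimes> r)), (q, \<one>), (r, \<one>)))"
  by (auto simp: smash_associator_def lincomb_def thetaF_def tensor_bv intro!: ext sum.cong)

text \<open>Each term of the associator is inverted separately: the arrow
  \<open>f = \<theta>(q, r)\<close> at \<open>p\<close> becomes \<open>inv f\<close> at
  \<open>p \<triangleleft> f\<close>, divided by the coefficient \<open>\<omega> p q r\<close> and
  by \<open>\<sigma>\<^sub>p(f, inv f)\<close>.\<close>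

definition associator_inv :: "('g \<times> 'g) \<times> ('g \<times> 'g) \<times> ('g \<times> 'g) \<Rightarrow> 'k" where
  "associator_inv = lincomb (Q \<times> Q \<times> Q)
    (\<lambda>(p, q, r). inverse (\<omega> p q r) * inverse (\<omega> p (Fp (q \<otimes> r)) (inv (Fp (q \<otimes> r)))))
    (\<lambda>(p, q, r). ((Qp (p \<otimes> Fp (q \<otimes> r)), inv (Fp (q \<otimes> r))), (q, \<one>), (r, \<one>)))"

lemma one_A3: "\<one>\<^bsub>tensor_cube A\<^esub> = lincomb (Q \<times> Q \<times> Q) (\<lambda>_. 1) (\<lambda>(p, q, r). ((p, \<one>), (q, \<one>), (r, \<one>)))"
  by (auto simp: one_tensor one_A tensor_lincomb intro!: lincomb_cong)

text \<open>The scalars obtained by composing an arrow with its inverse arrow in the two orders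
  agree, as needed for a two-sided inverse.\<close>

lemma omega_swap_inv:
  assumes "p \<in> carrier G" "f \<in> F"
  shows "\<omega> (p \<otimes> inv f) f (inv f) = \<omega> p (inv f) f"
  using omega_cocycle[of p "inv f" f "inv f"] assms by simp

lemma Qp_act_inj:
  assumes "p \<in> Q" "p' \<in> Q" "f \<in> F"
  shows "Qp (p \<otimes> f) = Qp (p' \<otimes> f) \<longleftrightarrow> p = p'"
proof
  assume "Qp (p \<otimes> f) = Qp (p' \<otimes> f)"
  then have "Qp (Qp (p \<otimes> f) \<otimes> inv f) = Qp (Qp (p' \<otimes> f) \<otimes> inv f)" by simp
  then show "p = p'" using assms by (simp add: m_assoc)
qed simp

lemma associator_inverse:
  "\<Phi> \<otimes>\<^bsub>tensor_cube A\<^esub> associator_inv = \<one>\<^bsub>tensor_cube A\<^esub>"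
  "associator_inv \<otimes>\<^bsub>tensor_cube A\<^esub> \<Phi> = \<one>\<^bsub>tensor_cube A\<^esub>"
proof -
  show "\<Phi> \<otimes>\<^bsub>tensor_cube A\<^esub> associator_inv = \<one>\<^bsub>tensor_cube A\<^esub>"
    unfolding associator_eq associator_inv_def one_A3
    apply (subst A3.lincomb_mult[where P = "Q \<times> Q \<times> Q" and f = "\<lambda>n. n" and g = "\<lambda>n. n"])
           apply (auto simp: inj_on_def m_assoc Qp_act_inj split: if_splits intro!: lincomb_cong)
    by (simp add: field_simps)
  show "associator_inv \<otimes>\<^bsub>tensor_cube A\<^esub> \<Phi> = \<one>\<^bsub>tensor_cube A\<^esub>"
    unfolding associator_eq associator_inv_def one_A3
    apply (subst A3.lincomb_mult[where P = "Q \<times> Q \<times> Q" and f = "\<lambda>n. n" and g = "\<lambda>n. n"])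
            apply (auto simp: inj_on_def m_assoc split: if_splits)[6]
    \<comment> \<open>In this order the composite is the identity arrow at the target
      \<open>p \<triangleleft> \<theta>(q, r)\<close>, so the first index must be
      translated.\<close>
    by (rule lincomb_bij_witness[where i = "\<lambda>(p, q, r). (Qp (p \<otimes> inv (Fp (q \<otimes> r))), q, r)"
          and j = "\<lambda>(p, q, r). (Qp (p \<otimes> Fp (q \<otimes> r)), q, r)"])
      (auto simp: m_assoc omega_swap_inv field_simps)
qed

lemma associator_closed: "\<Phi> \<in> vec_on (ixs (tensor_cube A))" "associator_inv \<in> vec_on (ixs (tensor_cube A))"
  unfolding associator_eq associator_inv_def by (rule lincomb_closed; auto)+

sublocale A3_alg: based_algebra "tensor_cube A"
  by (rule A3.is_based_algebra)

lemma associator_Units: "\<Phi> \<in> Units (tensor_cube A)"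
  using associator_closed associator_inverse by (auto simp: Units_def A3.carrier_eq)

lemma m_inv_associator: "inv\<^bsub>tensor_cube A\<^esub> \<Phi> = associator_inv"
  using associator_closed associator_inverse A3_alg.inv_unique'[of \<Phi> associator_inv] by (simp add: A3.carrier_eq)

section \<open>The counit axioms\<close>

lemma counit_assoc:
  "(\<lambda>(a, c). \<Sum>b\<in>Q \<times> F. \<Phi> (a, b, c) * smash_counit G F Q (bv b)) = \<one>\<^bsub>tensor_sq A\<^esub>"
proof -
  have "(\<lambda>(a, c). \<Sum>b\<in>Q \<times> F. \<Phi> (a, b, c) * smash_counit G F Q (bv b))
    = (\<lambda>(a, c). lincomb (Q \<times> Q \<times> Q) (\<lambda>n. (case n of (p, q, r) \<Rightarrow> \<omega> p q r) * smash_counit G F Q (bv (fst (snd n), \<one>)))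
      (\<lambda>(p, q, r). ((p, Fp (q \<otimes> r)), (r, \<one>))) (a, c))"
    unfolding associator_eq
    by (intro ext, clarify, rule sum_lincomb_contract) (auto simp: bv_Pair)
  also have "\<dots> = lincomb (Q \<times> Q \<times> Q) (\<lambda>(p, q, r). if q = \<one> then 1 else 0)
      (\<lambda>(p, q, r). ((p, Fp (q \<otimes> r)), (r, \<one>)))"
    by (auto simp: counit_bv intro!: fun_cong[OF lincomb_cong])
  also have "\<dots> = lincomb (Q \<times> {\<one>} \<times> Q) (\<lambda>(p, q, r). if q = \<one> then 1 else 0)
      (\<lambda>(p, q, r). ((p, Fp (q \<otimes> r)), (r, \<one>)))"
    by (rule lincomb_supp) (auto split: if_splits)
  also have "\<dots> = lincomb (Q \<times> Q) (\<lambda>_. 1) (\<lambda>(p, r). ((p, \<one>), (r, \<one>)))"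
    by (rule lincomb_bij_witness[where i = "\<lambda>(p, r). (p, \<one>, r)" and j = "\<lambda>(p, q, r). (p, r)"]) auto
  also have "\<dots> = \<one>\<^bsub>tensor_sq A\<^esub>"
    by (auto simp: one_tensor one_A tensor_lincomb intro!: lincomb_cong)
  finally show ?thesis .
qed

lemma counit_left:
  assumes "h \<in> vec_on (Q \<times> F)"
  shows "(\<lambda>b. \<Sum>a\<in>Q \<times> F. smash_counit G F Q (bv a) * \<Delta> h (a, b)) = h"
proof -
  have "(\<lambda>b. \<Sum>a\<in>Q \<times> F. smash_counit G F Q (bv a) * \<Delta> h (a, b))
      = lincomb (Q \<times> Q \<times> F) (\<lambda>n. (case n of (s, t, x) \<Rightarrow> h (Qp (s \<otimes> t), x) * \<omega> s t x)
          * smash_counit G F Q (bv (case n of (s, t, x) \<Rightarrow> (s, Fp (t \<otimes> x))))) (\<lambda>(s, t, x). (t, x))"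
    unfolding comult_eq[OF assms]
    by (intro ext) (subst mult.commute, rule sum_lincomb_contract, auto simp: bv_Pair)
  also have "\<dots> = lincomb (Q \<times> Q \<times> F) (\<lambda>(s, t, x). if s = \<one> then h (t, x) else 0) (\<lambda>(s, t, x). (t, x))"
    by (rule lincomb_cong) (auto simp: counit_bv)
  also have "\<dots> = lincomb ({\<one>} \<times> Q \<times> F) (\<lambda>(s, t, x). if s = \<one> then h (t, x) else 0) (\<lambda>(s, t, x). (t, x))"
    by (rule lincomb_supp) (auto split: if_splits)
  also have "\<dots> = lincomb (Q \<times> F) h (\<lambda>b. b)"
    by (rule lincomb_bij_witness[where i = "\<lambda>b. (\<one>, b)" and j = snd]) auto
  finally show ?thesis
    using vec_eq_lincomb[OF _ assms] by simp
qed

lemma counit_right: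
  assumes "h \<in> vec_on (Q \<times> F)"
  shows "(\<lambda>a. \<Sum>b\<in>Q \<times> F. \<Delta> h (a, b) * smash_counit G F Q (bv b)) = h"
proof -
  have "(\<lambda>a. \<Sum>b\<in>Q \<times> F. \<Delta> h (a, b) * smash_counit G F Q (bv b))
      = lincomb (Q \<times> Q \<times> F) (\<lambda>n. (case n of (s, t, x) \<Rightarrow> h (Qp (s \<otimes> t), x) * \<omega> s t x)
          * smash_counit G F Q (bv (case n of (s, t, x) \<Rightarrow> (t, x)))) (\<lambda>(s, t, x). (s, Fp (t \<otimes> x)))"
    unfolding comult_eq[OF assms]
    by (intro ext) (rule sum_lincomb_contract, auto simp: bv_Pair)
  also have "\<dots> = lincomb (Q \<times> Q \<times> F) (\<lambda>(s, t, x). if t = \<one> then h (s, x) else 0) (\<lambda>(s, t, x). (s, Fp (t \<otimes> x)))"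
    by (rule lincomb_cong) (auto simp: counit_bv)
  also have "\<dots> = lincomb (Q \<times> {\<one>} \<times> F) (\<lambda>(s, t, x). if t = \<one> then h (s, x) else 0) (\<lambda>(s, t, x). (s, Fp (t \<otimes> x)))"
    by (rule lincomb_supp) (auto split: if_splits)
  also have "\<dots> = lincomb (Q \<times> F) h (\<lambda>b. b)"
    by (rule lincomb_bij_witness[where i = "\<lambda>(s, x). (s, \<one>, x)" and j = "\<lambda>(s, t, x). (s, x)"]) auto
  finally show ?thesis
    using vec_eq_lincomb[OF _ assms] by simp
qed

section \<open>Quasi-coassociativity\<close>

lemma comult_comult_left:
  assumes "h \<in> vec_on (Q \<times> F)"
  shows "reassoc (tensor_map (Q \<times> F) (Q \<times> F) \<Delta> id (\<Delta> h)) = lincomb (Q \<times> Q \<times> Q \<times> F)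
    (\<lambda>(a, b, c, x). h (Qp (a \<otimes> b \<otimes> c), x) * \<omega> (a \<otimes> b) c x * \<omega> a b (Fp (c \<otimes> x)))
    (\<lambda>(a, b, c, x). ((a, Fp (b \<otimes> Fp (c \<otimes> x))), (b, Fp (c \<otimes> x)), (c, x)))"
  unfolding comult_eq[OF assms]
  apply (subst tensor_map_lincomb[where P = "\<lambda>(s, t, x). factors s" and R = "\<lambda>_. {()}"
        and ?\<gamma>1.0 = "\<lambda>(s, t, x) (a, b). \<omega> a b (Fp (t \<otimes> x))" and ?\<gamma>2.0 = "\<lambda>_ _. 1"
        and ?\<phi>1.0 = "\<lambda>(s, t, x) (a, b). ((a, Fp (b \<otimes> Fp (t \<otimes> x))), (b, Fp (t \<otimes> x)))"
        and ?\<phi>2.0 = "\<lambda>(s, t, x) _. (t, x)"])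
          apply (auto simp: comult_bv id_bv simp del: id_apply)[8]
  unfolding reassoc_lincomb
  by (rule lincomb_bij_witness[where i = "\<lambda>(a, b, c, x). ((Qp (a \<otimes> b), c, x), (a, b), ())"
        and j = "\<lambda>((s, t, x), (a, b), u). (a, b, t, x)"]) (auto simp: factors_def)

lemma comult_comult_right:
  assumes "h \<in> vec_on (Q \<times> F)"
  shows "tensor_map (Q \<times> F) (Q \<times> F) id \<Delta> (\<Delta> h) = lincomb (Q \<times> Q \<times> Q \<times> F)
    (\<lambda>(a, b, c, x). h (Qp (a \<otimes> Qp (b \<otimes> c)), x) * \<omega> a (Qp (b \<otimes> c)) x * \<omega> b c x)
    (\<lambda>(a, b, c, x). ((a, Fp (Qp (b \<otimes> c) \<otimes> x)), (b, Fp (c \<otimes> x)), (c, x)))"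
  unfolding comult_eq[OF assms]
  apply (subst tensor_map_lincomb[where R = "\<lambda>(s, t, x). factors t" and P = "\<lambda>_. {()}"
        and ?\<gamma>2.0 = "\<lambda>(s, t, x) (a, b). \<omega> a b x" and ?\<gamma>1.0 = "\<lambda>_ _. 1"
        and ?\<phi>2.0 = "\<lambda>(s, t, x) (a, b). ((a, Fp (b \<otimes> x)), (b, x))"
        and ?\<phi>1.0 = "\<lambda>(s, t, x) _. (s, Fp (t \<otimes> x))"])
          apply (auto simp: comult_bv id_bv simp del: id_apply)[8]
  by (rule lincomb_bij_witness[where i = "\<lambda>(a, b, c, x). ((a, Qp (b \<otimes> c), x), (), (b, c))"
        and j = "\<lambda>((s, t, x), u, (b, c)). (s, b, c, x)"]) (auto simp: factors_def)

text \<open>Without the inverse associator, both sides are sums over the same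
  \<open>(a, b, c, x)\<close>, and \<open>omega_four\<close> with \<open>x\<close> in
  \<open>F\<close> equates the coefficients.\<close>

lemma quasi_coassoc_aux:
  assumes "h \<in> vec_on (Q \<times> F)"
  shows "reassoc (tensor_map (Q \<times> F) (Q \<times> F) \<Delta> id (\<Delta> h)) \<otimes>\<^bsub>tensor_cube A\<^esub> \<Phi>
    = \<Phi> \<otimes>\<^bsub>tensor_cube A\<^esub> tensor_map (Q \<times> F) (Q \<times> F) id \<Delta> (\<Delta> h)"
proof -
  have "reassoc (tensor_map (Q \<times> F) (Q \<times> F) \<Delta> id (\<Delta> h)) \<otimes>\<^bsub>tensor_cube A\<^esub> \<Phi>
    = lincomb (Q \<times> Q \<times> Q \<times> F)
    (\<lambda>(a, b, c, x). h (Qp (a \<otimes> b \<otimes> c), x) * (\<omega> (a \<otimes> b) c x * \<omega> a b (Fp (c \<otimes> x))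
      * \<omega> (a \<otimes> Fp (b \<otimes> Fp (c \<otimes> x))) (Qp (b \<otimes> Fp (c \<otimes> x))) (Qp (c \<otimes> x))
      * \<omega> a (Fp (b \<otimes> Fp (c \<otimes> x))) (Fp (Qp (b \<otimes> Fp (c \<otimes> x)) \<otimes> Qp (c \<otimes> x)))))
    (\<lambda>(a, b, c, x). ((a, Fp (b \<otimes> (c \<otimes> x))), (b, Fp (c \<otimes> x)), (c, x)))"
    unfolding comult_comult_left[OF assms] associator_eq
    by (subst A3.lincomb_mult[where P = "Q \<times> Q \<times> Q \<times> F" and f = "\<lambda>n. n"
        and g = "\<lambda>(a, b, c, x). (Qp (a \<otimes> Fp (b \<otimes> Fp (c \<otimes> x))), Qp (b \<otimes> Fp (c \<otimes> x)), Qp (c \<otimes> x))"])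
      (auto simp: inj_on_def m_assoc split: if_splits intro!: lincomb_cong)
  also have "\<dots> = \<Phi> \<otimes>\<^bsub>tensor_cube A\<^esub> tensor_map (Q \<times> F) (Q \<times> F) id \<Delta> (\<Delta> h)"
    unfolding comult_comult_right[OF assms] associator_eq
    by (subst A3.lincomb_mult[where P = "Q \<times> Q \<times> Q \<times> F" and f = "\<lambda>(a, b, c, x). (a, b, c)"
        and g = "\<lambda>(a, b, c, x). (Qp (a \<otimes> Fp (b \<otimes> c)), b, c, x)"])
      (auto simp: inj_on_def m_assoc omega_four split: if_splits intro!: lincomb_cong)
  finally show ?thesis .
qed

text \<open>The order of the factors is that of conjugation by the associator in the opposite
  algebra, written with the multiplication of \<open>A\<close>.\<close>

lemma quasi_coassoc:
  assumes "h \<in> vec_on (Q \<times> F)"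
  shows "associator_inv \<otimes>\<^bsub>tensor_cube A\<^esub> (reassoc (tensor_map (Q \<times> F) (Q \<times> F) \<Delta> id (\<Delta> h)) \<otimes>\<^bsub>tensor_cube A\<^esub> \<Phi>)
    = tensor_map (Q \<times> F) (Q \<times> F) id \<Delta> (\<Delta> h)"
proof -
  have cl: "tensor_map (Q \<times> F) (Q \<times> F) id \<Delta> (\<Delta> h) \<in> vec_on (ixs (tensor_cube A))"
    unfolding comult_comult_right[OF assms] by (rule lincomb_closed) auto
  have "associator_inv \<otimes>\<^bsub>tensor_cube A\<^esub> (reassoc (tensor_map (Q \<times> F) (Q \<times> F) \<Delta> id (\<Delta> h)) \<otimes>\<^bsub>tensor_cube A\<^esub> \<Phi>)
    = (associator_inv \<otimes>\<^bsub>tensor_cube A\<^esub> \<Phi>) \<otimes>\<^bsub>tensor_cube A\<^esub> tensor_map (Q \<times> F) (Q \<times> F) id \<Delta> (\<Delta> h)"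
    unfolding quasi_coassoc_aux[OF assms]
    by (rule A3.mult_assoc[symmetric]) (use associator_closed cl in auto)
  also have "\<dots> = tensor_map (Q \<times> F) (Q \<times> F) id \<Delta> (\<Delta> h)"
    unfolding associator_inverse by (rule A3.one_mult[OF cl])
  finally show ?thesis .
qed

section \<open>The pentagon identity\<close>

lemma pentagon_id_id_comult:
  "tensor_map (Q \<times> F) ((Q \<times> F) \<times> (Q \<times> F)) id (tensor_map (Q \<times> F) (Q \<times> F) id \<Delta>) \<Phi>
    = lincomb (Q \<times> Q \<times> Q \<times> Q) (\<lambda>(a, b, c, d). \<omega> a b (Qp (c \<otimes> d)))
      (\<lambda>(a, b, c, d). ((a, Fp (b \<otimes> Qp (c \<otimes> d))), (b, \<one>), (c, \<one>), (d, \<one>)))"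
proof -
  \<comment> \<open>On an identity arrow the comultiplication only factors the index: all
    coefficients \<open>\<omega> s t \<one>\<close> are 1.\<close>
  have *: "tensor_map (Q \<times> F) (Q \<times> F) id \<Delta> (bv ((q, \<one>), (r, \<one>)))
     = lincomb (factors r) (\<lambda>_. 1) (\<lambda>(c, d). ((q, \<one>), (c, \<one>), (d, \<one>)))" if "q \<in> Q" "r \<in> Q" for q r
  proof -
    have "tensor_map (Q \<times> F) (Q \<times> F) id \<Delta> (bv ((q, \<one>), (r, \<one>)))
       = tensor (lincomb {()} (\<lambda>_. 1) (\<lambda>_. (q, \<one>))) (lincomb (factors r) (\<lambda>(s, t). \<omega> s t \<one>) (\<lambda>(s, t). ((s, Fp (t \<otimes> \<one>)), (t, \<one>))))"
      using that by (subst tensor_map_bv) (auto simp: comult_bv bv_eq_lincomb[symmetric])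
    also have "\<dots> = lincomb (factors r) (\<lambda>_. 1) (\<lambda>(c, d). ((q, \<one>), (c, \<one>), (d, \<one>)))"
      unfolding tensor_lincomb
      by (rule lincomb_bij_witness[where i = "\<lambda>st. ((), st)" and j = snd]) (auto simp: factors_def)
    finally show ?thesis .
  qed
  show ?thesis
    unfolding associator_eq
    apply (subst tensor_map_lincomb[where P = "\<lambda>_. {()}" and R = "\<lambda>(p, q, r). factors r"
        and ?\<gamma>1.0 = "\<lambda>_ _. 1" and ?\<gamma>2.0 = "\<lambda>_ _. 1"
        and ?\<phi>1.0 = "\<lambda>(p, q, r) _. (p, Fp (q \<otimes> r))"
        and ?\<phi>2.0 = "\<lambda>(p, q, r) (c, d). ((q, \<one>), (c, \<one>), (d, \<one>))"])
            apply (auto simp: * id_bv simp del: id_apply)[8]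
    by (rule lincomb_bij_witness[where i = "\<lambda>(a, b, c, d). ((a, b, Qp (c \<otimes> d)), (), (c, d))"
        and j = "\<lambda>((a, b, r), u, (c, d)). (a, b, c, d)"]) (auto simp: factors_def)
qed

lemma pentagon_comult_id_id:
  "reassoc (tensor_map (Q \<times> F) ((Q \<times> F) \<times> (Q \<times> F)) \<Delta> id \<Phi>)
    = lincomb (Q \<times> Q \<times> Q \<times> Q) (\<lambda>(a, b, c, d). \<omega> (a \<otimes> b) c d * \<omega> a b (Fp (c \<otimes> d)))
      (\<lambda>(a, b, c, d). ((a, Fp (b \<otimes> Fp (c \<otimes> d))), (b, Fp (c \<otimes> d)), (c, \<one>), (d, \<one>)))"
  unfolding associator_eq
  apply (subst tensor_map_lincomb[where R = "\<lambda>_. {()}" and P = "\<lambda>(p, q, r). factors p"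
      and ?\<gamma>1.0 = "\<lambda>(p, q, r) (a, b). \<omega> a b (Fp (q \<otimes> r))" and ?\<gamma>2.0 = "\<lambda>_ _. 1"
      and ?\<phi>1.0 = "\<lambda>(p, q, r) (a, b). ((a, Fp (b \<otimes> Fp (q \<otimes> r))), (b, Fp (q \<otimes> r)))"
      and ?\<phi>2.0 = "\<lambda>(p, q, r) _. ((q, \<one>), (r, \<one>))"])
          apply (auto simp: comult_bv id_bv simp del: id_apply)[8]
  unfolding reassoc_lincomb
  by (rule lincomb_bij_witness[where i = "\<lambda>(a, b, c, d). ((Qp (a \<otimes> b), c, d), (a, b), ())"
      and j = "\<lambda>((p, c, d), (a, b), u). (a, b, c, d)"]) (auto simp: factors_def)

lemma pentagon_one_tensor:
  "tensor \<one>\<^bsub>A\<^esub> \<Phi> = lincomb (Q \<times> Q \<times> Q \<times> Q) (\<lambda>(a, b, c, d). \<omega> b c d)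
    (\<lambda>(a, b, c, d). ((a, \<one>), (b, Fp (c \<otimes> d)), (c, \<one>), (d, \<one>)))"
  unfolding associator_eq one_A tensor_lincomb by (rule lincomb_cong) auto

lemma pentagon_tensor_one:
  "(\<lambda>(a, b, c, d). \<Phi> (a, b, c) * \<one>\<^bsub>A\<^esub> d) = lincomb (Q \<times> Q \<times> Q \<times> Q) (\<lambda>(a, b, c, d). \<omega> a b c)
    (\<lambda>(a, b, c, d). ((a, Fp (b \<otimes> c)), (b, \<one>), (c, \<one>), (d, \<one>)))"
proof -
  have "(\<lambda>(a, b, c, d). \<Phi> (a, b, c) * \<one>\<^bsub>A\<^esub> d) = (\<lambda>(a, b, c, d). tensor \<Phi> \<one>\<^bsub>A\<^esub> ((a, b, c), d))"
    by (simp add: tensor_def)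
  also have "\<dots> = lincomb ((Q \<times> Q \<times> Q) \<times> Q) (\<lambda>((a, b, c), d). \<omega> a b c)
    (\<lambda>((a, b, c), d). ((a, Fp (b \<otimes> c)), (b, \<one>), (c, \<one>), (d, \<one>)))"
    unfolding associator_eq one_A tensor_lincomb
    by (auto simp: lincomb_def bv_Pair mult_ac intro!: ext sum.cong)
  also have "\<dots> = lincomb (Q \<times> Q \<times> Q \<times> Q) (\<lambda>(a, b, c, d). \<omega> a b c)
    (\<lambda>(a, b, c, d). ((a, Fp (b \<otimes> c)), (b, \<one>), (c, \<one>), (d, \<one>)))"
    by (rule lincomb_bij_witness[where i = "\<lambda>(a, b, c, d). ((a, b, c), d)" and j = "\<lambda>((a, b, c), d). (a, b, c, d)"]) auto
  finally show ?thesis .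
qed

lemma pentagon_id_comult_id:
  "tensor_map (Q \<times> F) ((Q \<times> F) \<times> (Q \<times> F)) id (\<lambda>w. reassoc (tensor_map (Q \<times> F) (Q \<times> F) \<Delta> id w)) \<Phi>
    = lincomb (Q \<times> Q \<times> Q \<times> Q) (\<lambda>(a, b, c, d). \<omega> a (Qp (b \<otimes> c)) d)
      (\<lambda>(a, b, c, d). ((a, Fp (Qp (b \<otimes> c) \<otimes> d)), (b, \<one>), (c, \<one>), (d, \<one>)))"
proof -
  have *: "reassoc (tensor_map (Q \<times> F) (Q \<times> F) \<Delta> id (bv ((q, \<one>), (r, \<one>))))
     = lincomb (factors q) (\<lambda>_. 1) (\<lambda>(b, c). ((b, \<one>), (c, \<one>), (r, \<one>)))" if "q \<in> Q" "r \<in> Q" for q r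
  proof -
    have "tensor_map (Q \<times> F) (Q \<times> F) \<Delta> id (bv ((q, \<one>), (r, \<one>)))
       = tensor (lincomb (factors q) (\<lambda>(s, t). \<omega> s t \<one>) (\<lambda>(s, t). ((s, Fp (t \<otimes> \<one>)), (t, \<one>)))) (lincomb {()} (\<lambda>_. 1) (\<lambda>_. (r, \<one>)))"
      using that by (subst tensor_map_bv) (auto simp: comult_bv bv_eq_lincomb[symmetric])
    then have "reassoc (tensor_map (Q \<times> F) (Q \<times> F) \<Delta> id (bv ((q, \<one>), (r, \<one>))))
       = reassoc (tensor (lincomb (factors q) (\<lambda>(s, t). \<omega> s t \<one>) (\<lambda>(s, t). ((s, Fp (t \<otimes> \<one>)), (t, \<one>)))) (lincomb {()} (\<lambda>_. 1) (\<lambda>_. (r, \<one>))))"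
      by simp
    also have "\<dots> = lincomb (factors q) (\<lambda>_. 1) (\<lambda>(b, c). ((b, \<one>), (c, \<one>), (r, \<one>)))"
      unfolding tensor_lincomb reassoc_lincomb
      by (rule lincomb_bij_witness[where i = "\<lambda>st. (st, ())" and j = fst]) (auto simp: factors_def)
    finally show ?thesis .
  qed
  show ?thesis
    unfolding associator_eq
    apply (subst tensor_map_lincomb[where P = "\<lambda>_. {()}" and R = "\<lambda>(p, q, r). factors q"
        and ?\<gamma>1.0 = "\<lambda>_ _. 1" and ?\<gamma>2.0 = "\<lambda>_ _. 1"
        and ?\<phi>1.0 = "\<lambda>(p, q, r) _. (p, Fp (q \<otimes> r))"
        and ?\<phi>2.0 = "\<lambda>(p, q, r) (b, c). ((b, \<one>), (c, \<one>), (r, \<one>))"])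
            apply (auto simp: * id_bv simp del: id_apply)[8]
    by (rule lincomb_bij_witness[where i = "\<lambda>(a, b, c, d). ((a, Qp (b \<otimes> c), d), (), (b, c))"
        and j = "\<lambda>((a, q, d), u, (b, c)). (a, b, c, d)"]) (auto simp: factors_def)
qed

text \<open>Products are reversed because the axiom concerns the opposite algebra. Both sides are
  indexed by four elements of \<open>Q\<close>, and \<open>omega_four\<close> with its last argument
  in \<open>Q\<close> equates the coefficients.\<close>

lemma pentagon:
  "reassoc (tensor_map (Q \<times> F) ((Q \<times> F) \<times> (Q \<times> F)) \<Delta> id \<Phi>)
     \<otimes>\<^bsub>tensor_fourth A\<^esub> tensor_map (Q \<times> F) ((Q \<times> F) \<times> (Q \<times> F)) id (tensor_map (Q \<times> F) (Q \<times> F) id \<Delta>) \<Phi>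
   = (\<lambda>(a, b, c, d). \<Phi> (a, b, c) * \<one>\<^bsub>A\<^esub> d)
     \<otimes>\<^bsub>tensor_fourth A\<^esub> (tensor_map (Q \<times> F) ((Q \<times> F) \<times> (Q \<times> F)) id
          (\<lambda>w. reassoc (tensor_map (Q \<times> F) (Q \<times> F) \<Delta> id w)) \<Phi>
     \<otimes>\<^bsub>tensor_fourth A\<^esub> tensor \<one>\<^bsub>A\<^esub> \<Phi>)"
proof -
  let ?Q4 = "Q \<times> Q \<times> Q \<times> Q"
  have r: "tensor_map (Q \<times> F) ((Q \<times> F) \<times> (Q \<times> F)) id
          (\<lambda>w. reassoc (tensor_map (Q \<times> F) (Q \<times> F) \<Delta> id w)) \<Phi>
     \<otimes>\<^bsub>tensor_fourth A\<^esub> tensor \<one>\<^bsub>A\<^esub> \<Phi>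
    = lincomb ?Q4 (\<lambda>(a, b, c, d). \<omega> a (Qp (b \<otimes> c)) d * \<omega> b c d)
      (\<lambda>(a, b, c, d). ((a, Fp (Qp (b \<otimes> c) \<otimes> d)), (b, Fp (c \<otimes> d)), (c, \<one>), (d, \<one>)))"
    unfolding pentagon_id_comult_id pentagon_one_tensor
    by (subst A4.lincomb_mult[where P = ?Q4 and f = "\<lambda>n. n"
        and g = "\<lambda>(a, b, c, d). (Qp (a \<otimes> Fp (Qp (b \<otimes> c) \<otimes> d)), b, c, d)"])
      (auto simp: inj_on_def split: if_splits intro!: lincomb_cong)
  have "reassoc (tensor_map (Q \<times> F) ((Q \<times> F) \<times> (Q \<times> F)) \<Delta> id \<Phi>)
     \<otimes>\<^bsub>tensor_fourth A\<^esub> tensor_map (Q \<times> F) ((Q \<times> F) \<times> (Q \<times> F)) id (tensor_map (Q \<times> F) (Q \<times> F) id \<Delta>) \<Phi>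
    = lincomb ?Q4 (\<lambda>(a, b, c, d). \<omega> (a \<otimes> b) c d * \<omega> a b (Fp (c \<otimes> d))
        * \<omega> (a \<otimes> Fp (b \<otimes> Fp (c \<otimes> d))) (Qp (b \<otimes> Fp (c \<otimes> d))) (Qp (c \<otimes> d))
        * \<omega> a (Fp (b \<otimes> Fp (c \<otimes> d))) (Fp (Qp (b \<otimes> Fp (c \<otimes> d)) \<otimes> Qp (c \<otimes> d))))
      (\<lambda>(a, b, c, d). ((a, Fp (b \<otimes> (c \<otimes> d))), (b, Fp (c \<otimes> d)), (c, \<one>), (d, \<one>)))"
    unfolding pentagon_id_id_comult pentagon_comult_id_id
    by (subst A4.lincomb_mult[where P = ?Q4 and f = "\<lambda>n. n"
        and g = "\<lambda>(a, b, c, d). (Qp (a \<otimes> Fp (b \<otimes> Fp (c \<otimes> d))), Qp (b \<otimes> Fp (c \<otimes> d)), c, d)"])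
      (auto simp: inj_on_def m_assoc split: if_splits intro!: lincomb_cong)
  also have "\<dots> = lincomb ?Q4 (\<lambda>(a, b, c, d). \<omega> a b c)
    (\<lambda>(a, b, c, d). ((a, Fp (b \<otimes> c)), (b, \<one>), (c, \<one>), (d, \<one>))) \<otimes>\<^bsub>tensor_fourth A\<^esub>
    lincomb ?Q4 (\<lambda>(a, b, c, d). \<omega> a (Qp (b \<otimes> c)) d * \<omega> b c d)
      (\<lambda>(a, b, c, d). ((a, Fp (Qp (b \<otimes> c) \<otimes> d)), (b, Fp (c \<otimes> d)), (c, \<one>), (d, \<one>)))"
    by (subst A4.lincomb_mult[where P = ?Q4 and f = "\<lambda>n. n"
        and g = "\<lambda>(a, b, c, d). (Qp (a \<otimes> Fp (b \<otimes> c)), b, c, d)"])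
      (auto simp: inj_on_def omega_four m_assoc split: if_splits intro!: lincomb_cong)
  finally show ?thesis
    unfolding r pentagon_tensor_one .
qed

section \<open>The antipode\<close>

definition antipode_index :: "'g \<times> 'g \<Rightarrow> 'g \<times> 'g" where
  "antipode_index = (\<lambda>(p, x). (R (Qp (p \<otimes> x)), inv (sc p x)))"

lemma antipode_index_simp [simp]: "antipode_index (p, x) = (R (Qp (p \<otimes> x)), inv (sc p x))"
  by (simp add: antipode_index_def)

definition antipode :: "('g \<times> 'g \<Rightarrow> 'k) \<Rightarrow> 'g \<times> 'g \<Rightarrow> 'k" where
  "antipode v = lincomb (Q \<times> F) (\<lambda>b. v b * case_prod antipode_coeff b) antipode_index"

lemma R_inj [simp]: "p \<in> Q \<Longrightarrow> q \<in> Q \<Longrightarrow> R p = R q \<longleftrightarrow> p = q"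
  by (metis L_R)

text \<open>The image arrow runs from \<open>R (p \<triangleleft> x)\<close> to \<open>R p\<close>.
  Its target decides what it composes with.\<close>

lemma Qp_antipode_index [simp]:
  assumes "p \<in> Q" "x \<in> F"
  shows "Qp (R (Qp (p \<otimes> x)) \<otimes> inv (sc p x)) = R p"
  using assms by (simp add: R_mult_inv_succF)

text \<open>The target of the image arrow determines \<open>R p\<close>, hence \<open>p\<close>;
  then \<open>p \<succ> x\<close> and the source determine \<open>x\<close>. Surjectivity follows
  because the index set is finite.\<close>

lemma antipode_index_bij: "bij_betw antipode_index (Q \<times> F) (Q \<times> F)"
proof -
  have "inj_on antipode_index (Q \<times> F)"
  proof (rule inj_onI, clarify)
    fix p x q y
    assume cl: "p \<in> Q" "x \<in> F" "q \<in> Q" "y \<in> F" and eq: "antipode_index (p, x) = antipode_index (q, y)"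
    then have "R p = R q"
      using Qp_antipode_index[of p x] Qp_antipode_index[of q y] by simp
    then have pq: "p = q" using cl by simp
    have "sc p x = sc q y"
      using eq cl by (metis antipode_index_simp prod.inject inv_inv F_carrier succF_closed)
    then have "x \<otimes> R (Qp (p \<otimes> x)) = y \<otimes> R (Qp (q \<otimes> y))"
      using R_mult_succF[of p x] R_mult_succF[of q y] cl pq by simp
    also have "R (Qp (q \<otimes> y)) = R (Qp (p \<otimes> x))"
      using eq by simp
    finally show "p = q \<and> x = y"
      using cl pq by simp
  qed
  moreover have "antipode_index ` (Q \<times> F) \<subseteq> Q \<times> F"
    by auto
  ultimately show ?thesis
    by (simp add: bij_betw_def endo_inj_surj)
qed

lemma antipode_index_closed: "antipode_index ` (Q \<times> F) \<subseteq> Q \<times> F"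
  using antipode_index_bij by (simp add: bij_betw_def)

lemma antipode_lincomb:
  assumes "\<phi> ` N \<subseteq> Q \<times> F"
  shows "antipode (lincomb N \<gamma> \<phi>) = lincomb N (\<lambda>n. \<gamma> n * case_prod antipode_coeff (\<phi> n)) (\<lambda>n. antipode_index (\<phi> n))"
proof
  fix d
  have "antipode (lincomb N \<gamma> \<phi>) d
      = (\<Sum>b\<in>Q \<times> F. lincomb N \<gamma> \<phi> b * (case_prod antipode_coeff b * bv (antipode_index b) d))"
    by (simp add: antipode_def lincomb_def[of "Q \<times> F"] mult.assoc)
  also have "\<dots> = lincomb N (\<lambda>n. \<gamma> n * case_prod antipode_coeff (\<phi> n)) (\<lambda>n. antipode_index (\<phi> n)) d"
    using assms by (subst sum_lincomb) (auto simp: lincomb_def mult.assoc)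
  finally show "antipode (lincomb N \<gamma> \<phi>) d = \<dots>" .
qed

lemma antipode_bv:
  assumes "p \<in> Q" "x \<in> F"
  shows "antipode (bv (p, x)) = scale (antipode_coeff p x) (bv (R (Qp (p \<otimes> x)), inv (sc p x)))"
  unfolding bv_eq_lincomb scale_lincomb
  by (subst antipode_lincomb) (use assms in \<open>auto intro!: lincomb_cong\<close>)

lemma antipode_closed: "antipode v \<in> vec_on (Q \<times> F)"
  unfolding antipode_def by (rule lincomb_closed[OF antipode_index_closed])

lemma antipode_linear: "linear_map_on (Q \<times> F) (Q \<times> F) antipode"
  unfolding linear_map_on_def
  by (auto simp: antipode_closed)
    (auto simp: antipode_def lincomb_def vadd_def scale_def distrib_right sum.distrib
      sum_distrib_left mult.assoc)

lemma antipode_apply: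
  assumes "b \<in> Q \<times> F"
  shows "antipode v (antipode_index b) = v b * case_prod antipode_coeff b"
proof -
  have "antipode v (antipode_index b) = (\<Sum>b'\<in>Q \<times> F. if b' = b then v b' * case_prod antipode_coeff b' else 0)"
    unfolding antipode_def lincomb_def bv_def
    by (intro sum.cong refl)
      (use assms inj_on_eq_iff[OF bij_betw_imp_inj_on[OF antipode_index_bij], of b] in \<open>auto simp del: antipode_index_simp\<close>)
  then show ?thesis
    using assms by simp
qed

text \<open>The antipode permutes the basis up to nonzero scalars, so a preimage is found by reading
  coefficients along \<open>antipode_index\<close> and dividing.\<close>

lemma antipode_bij: "bij_betw antipode (vec_on (Q \<times> F)) (vec_on (Q \<times> F))"
proof (rule bij_betwI')
  fix v w :: "'g \<times> 'g \<Rightarrow> 'k" assume vw: "v \<in> vec_on (Q \<times> F)" "w \<in> vec_on (Q \<times> F)"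
  show "antipode v = antipode w \<longleftrightarrow> v = w"
  proof
    assume eq: "antipode v = antipode w"
    have "v b = w b" for b
    proof (cases "b \<in> Q \<times> F")
      case True
      then have "v b * case_prod antipode_coeff b = w b * case_prod antipode_coeff b"
        using antipode_apply[OF True] eq by metis
      moreover have "case_prod antipode_coeff b \<noteq> 0"
        using True antipode_coeff_nz by (cases b) auto
      ultimately show ?thesis by simp
    next
      case False
      then show ?thesis using vw by (cases b) (auto simp: vec_on_def)
    qed
    then show "v = w" by (rule ext)
  qed simp
next
  fix v :: "'g \<times> 'g \<Rightarrow> 'k"
  show "antipode v \<in> vec_on (Q \<times> F)" by (rule antipode_closed)
  assume v: "v \<in> vec_on (Q \<times> F)"
  define w where "w = (\<lambda>b. if b \<in> Q \<times> F then v (antipode_index b) / case_prod antipode_coeff b else 0)"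
  have "antipode w = lincomb (Q \<times> F) (\<lambda>b. v (antipode_index b)) antipode_index"
    unfolding antipode_def by (rule lincomb_cong) (auto simp: w_def antipode_coeff_nz)
  also have "\<dots> = lincomb (Q \<times> F) v (\<lambda>b. b)"
    unfolding lincomb_def
    by (rule ext, rule sum.reindex_bij_betw[OF antipode_index_bij])
  also have "\<dots> = v"
    using vec_eq_lincomb[OF _ v] by simp
  finally show "\<exists>w\<in>vec_on (Q \<times> F). v = antipode w"
    by (intro bexI[of _ w]) (auto simp: w_def vec_on_def)
qed

text \<open>Oriented against \<open>Qp_Qp_mult\<close>, to reach the nested form of the action in
  which \<open>antipode_coeff_mult\<close> is stated.\<close>

lemma Qp_act_mult:
  assumes "p \<in> carrier G" "x \<in> carrier G" "y \<in> carrier G"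
  shows "Qp (p \<otimes> (x \<otimes> y)) = Qp (Qp (p \<otimes> x) \<otimes> y)"
  using assms by (simp add: m_assoc)

lemma antipode_mult:
  assumes "v \<in> vec_on (Q \<times> F)" "w \<in> vec_on (Q \<times> F)"
  shows "antipode (v \<otimes>\<^bsub>A\<^esub> w) = antipode w \<otimes>\<^bsub>A\<^esub> antipode v"
proof -
  let ?r = "lincomb (Q \<times> F \<times> F)
    (\<lambda>(p, x, y). v (p, x) * w (Qp (p \<otimes> x), y) * (\<omega> p x y * antipode_coeff p (x \<otimes> y)))
    (\<lambda>(p, x, y). (R (Qp (Qp (p \<otimes> x) \<otimes> y)), inv (sc p (x \<otimes> y))))"
  have "antipode (v \<otimes>\<^bsub>A\<^esub> w) = ?r"
    unfolding mult_A_eq[OF assms]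
    by (subst antipode_lincomb) (auto simp: Qp_act_mult simp del: Qp_Qp_mult intro!: lincomb_cong)
  also have "?r = antipode w \<otimes>\<^bsub>A\<^esub> antipode v"
    unfolding antipode_def
    \<comment> \<open>The image of the second arrow ends where the image of the first begins, so
      composable pairs \<open>(p, x, y)\<close> correspond to each other in reversed order.\<close>
    apply (subst A.lincomb_mult[where P = "Q \<times> F \<times> F" and f = "\<lambda>(p, x, y). (Qp (p \<otimes> x), y)"
          and g = "\<lambda>(p, x, y). (p, x)"])
          apply (auto simp: inj_on_def simp del: Qp_Qp_mult split: if_splits)[6]
    by (rule lincomb_cong)
      (auto simp: antipode_coeff_mult succF_mult inv_mult_group simp del: Qp_Qp_mult)
  finally show ?thesis .
qed

lemma sum_R:
  "(\<Sum>q\<in>Q. f (R q)) = (\<Sum>q\<in>Q. f q)"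
  by (rule sum.reindex_bij_witness[where i = L and j = R]) auto

lemma antipode_one: "antipode \<one>\<^bsub>A\<^esub> = \<one>\<^bsub>A\<^esub>"
  unfolding one_A
  by (subst antipode_lincomb) (auto intro!: lincomb_bij_witness[where i = L and j = R])

section \<open>The element \<open>\<beta>\<close>\<close>

definition beta_coeff :: "'g \<Rightarrow> 'k" where "beta_coeff q = \<omega> (inv q) q (inv q)"

lemma beta_coeff_nz [simp]: "q \<in> carrier G \<Longrightarrow> beta_coeff q \<noteq> 0"
  by (simp add: beta_coeff_def)

text \<open>Since \<open>L q.q = e\<close>, the product of \<open>L q\<close> and \<open>q\<close>
  lies in \<open>F\<close> and is \<open>\<theta>(q^L, q)\<close>.\<close>

definition beta :: "'g \<times> 'g \<Rightarrow> 'k" where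
  "beta = lincomb Q beta_coeff (\<lambda>q. (q, inv (L q \<otimes> q)))"

lemma beta_closed: "beta \<in> vec_on (Q \<times> F)"
  unfolding beta_def by (rule lincomb_closed) auto

lemma one_closed: "\<one>\<^bsub>A\<^esub> \<in> vec_on (Q \<times> F)"
  using A.one_closed by simp

lemma bv_mult_beta:
  assumes "p \<in> Q" "x \<in> F"
  shows "bv (p, x) \<otimes>\<^bsub>A\<^esub> beta = scale (beta_coeff (Qp (p \<otimes> x)) * \<omega> p x (inv (L (Qp (p \<otimes> x)) \<otimes> Qp (p \<otimes> x))))
    (bv (p, x \<otimes> inv (L (Qp (p \<otimes> x)) \<otimes> Qp (p \<otimes> x))))"
proof -
  have "lincomb {()} (\<lambda>_. 1) (\<lambda>_. (p, x)) \<otimes>\<^bsub>A\<^esub> beta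
    = lincomb {()} (\<lambda>_. beta_coeff (Qp (p \<otimes> x)) * \<omega> p x (inv (L (Qp (p \<otimes> x)) \<otimes> Qp (p \<otimes> x))))
    (\<lambda>_. (p, x \<otimes> inv (L (Qp (p \<otimes> x)) \<otimes> Qp (p \<otimes> x))))"
    unfolding beta_def
    using assms by (subst A.lincomb_mult[where P = "{()}" and f = "\<lambda>_. ()" and g = "\<lambda>_. Qp (p \<otimes> x)"])
      (auto split: if_splits intro!: lincomb_cong)
  then show ?thesis
    by (simp add: lincomb_singleton)
qed

lemma bv_mult_beta_mult:
  assumes "p \<in> Q" "x \<in> F" "b \<in> Q \<times> F"
  shows "bv (p, x) \<otimes>\<^bsub>A\<^esub> (beta \<otimes>\<^bsub>A\<^esub> bv b)
    = scale (beta_coeff (Qp (p \<otimes> x)) * \<omega> p x (inv (L (Qp (p \<otimes> x)) \<otimes> Qp (p \<otimes> x)))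
        * smash_coeff (p, x \<otimes> inv (L (Qp (p \<otimes> x)) \<otimes> Qp (p \<otimes> x))) b)
    (bv (smash_index (p, x \<otimes> inv (L (Qp (p \<otimes> x)) \<otimes> Qp (p \<otimes> x))) b))"
proof -
  have "bv (p, x) \<otimes>\<^bsub>A\<^esub> (beta \<otimes>\<^bsub>A\<^esub> bv b) = (bv (p, x) \<otimes>\<^bsub>A\<^esub> beta) \<otimes>\<^bsub>A\<^esub> bv b"
    by (rule A.mult_assoc[symmetric]) (use assms beta_closed in \<open>auto intro: bv_in_vec_on\<close>)
  then show ?thesis
    using assms by (simp add: bv_mult_beta A.mult_scale_left A.bv_mult) (simp add: scale_def mult.assoc)
qed

section \<open>The antipode axioms\<close>

text \<open>The left equation says that \<open>(s.t) \<triangleleft> x\<close> is the identity,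
  equivalently that \<open>s.t\<close> is. It selects the terms of the comultiplication that survive
  in the \<open>\<alpha>\<close> axiom.\<close>

lemma Qp_R_act_iff:
  assumes "s \<in> Q" "t \<in> Q" "x \<in> F"
  shows "Qp (t \<otimes> x) = R (Qp (s \<otimes> Fp (t \<otimes> x))) \<longleftrightarrow> t = R s"
proof
  assume "Qp (t \<otimes> x) = R (Qp (s \<otimes> Fp (t \<otimes> x)))"
  then have "Qp (s \<otimes> Fp (t \<otimes> x)) \<otimes> Qp (t \<otimes> x) \<in> F"
    using assms by simp
  then have "Qp (Qp (s \<otimes> Fp (t \<otimes> x)) \<otimes> Qp (t \<otimes> x)) = \<one>"
    by (rule parts_F(2))
  then have "Qp (s \<otimes> t \<otimes> x) = \<one>"
    using assms by (simp add: m_assoc)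
  then have "s \<otimes> t \<otimes> x \<in> F"
    using assms by (simp add: Qp_eq_one_iff)
  then have "s \<otimes> t \<otimes> x \<otimes> inv x \<in> F"
    by (rule F_mult[OF _ F_inv[OF assms(3)]])
  then have "s \<otimes> t \<in> F"
    using assms by (simp add: m_assoc)
  then show "t = R s"
    using R_eqI[OF assms(1,2)] by simp
qed (use assms R_Qp_act in simp)

text \<open>Only terms with \<open>t = R s\<close> compose, and there the antipode coefficient was
  chosen to cancel the scalars of the comultiplication and of the product, leaving the identity
  arrow at \<open>R s\<close>.\<close>

lemma antipode_alpha:
  assumes "h \<in> vec_on (Q \<times> F)"
  shows "(\<Sum>(a, b)\<in>(Q \<times> F) \<times> (Q \<times> F). \<Delta> h (a, b) * (bv b \<otimes>\<^bsub>A\<^esub> (\<one>\<^bsub>A\<^esub> \<otimes>\<^bsub>A\<^esub> antipode (bv a))) d)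
    = scale (smash_counit G F Q h) \<one>\<^bsub>A\<^esub> d"
proof -
  have "(\<Sum>(a, b)\<in>(Q \<times> F) \<times> (Q \<times> F). \<Delta> h (a, b) * (bv b \<otimes>\<^bsub>A\<^esub> (\<one>\<^bsub>A\<^esub> \<otimes>\<^bsub>A\<^esub> antipode (bv a))) d)
    = (\<Sum>(s, t, x)\<in>Q \<times> Q \<times> F. h (Qp (s \<otimes> t), x) * \<omega> s t x *
        (bv (t, x) \<otimes>\<^bsub>A\<^esub> antipode (bv (s, Fp (t \<otimes> x)))) d)"
    unfolding comult_eq[OF assms]
    by (subst sum2_lincomb) (auto simp: A.one_mult antipode_closed intro!: sum.cong)
  also have "\<dots> = (\<Sum>(s, t, x)\<in>Q \<times> Q \<times> F. if t = R s then h (\<one>, x) * bv (t, \<one>) d else 0)"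
  proof (rule sum.cong, simp, clarify)
    fix s t x assume cl: "s \<in> Q" "t \<in> Q" "x \<in> F"
    have "bv (t, x) \<otimes>\<^bsub>A\<^esub> antipode (bv (s, Fp (t \<otimes> x)))
      = scale (antipode_coeff s (Fp (t \<otimes> x)) * (if t = R s then \<omega> t x (inv (sc s (Fp (t \<otimes> x)))) else 0))
          (bv (t, x \<otimes> inv (sc s (Fp (t \<otimes> x)))))"
      using cl by (simp add: antipode_bv A.mult_scale_right A.bv_mult Qp_R_act_iff) (simp add: scale_def mult.assoc)
    then show "h (Qp (s \<otimes> t), x) * \<omega> s t x * (bv (t, x) \<otimes>\<^bsub>A\<^esub> antipode (bv (s, Fp (t \<otimes> x)))) d
      = (if t = R s then h (\<one>, x) * bv (t, \<one>) d else 0)"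
      using cl by (auto simp: scale_def antipode_coeff_act succF_act)
  qed
  also have "\<dots> = (\<Sum>s\<in>Q. \<Sum>t\<in>Q. if t = R s then (\<Sum>x\<in>F. h (\<one>, x) * bv (t, \<one>) d) else 0)"
    unfolding sum.cartesian_product' by (intro sum.cong refl) auto
  also have "\<dots> = (\<Sum>s\<in>Q. smash_counit G F Q h * bv (R s, \<one>) d)"
    by (simp add: counit_eq sum_distrib_right)
  also have "\<dots> = scale (smash_counit G F Q h) \<one>\<^bsub>A\<^esub> d"
    using sum_R[of "\<lambda>q. smash_counit G F Q h * bv (q, \<one>) d"]
    by (simp add: one_A lincomb_def scale_def sum_distrib_left)
  finally show ?thesis .
qed

text \<open>A rearrangement of the definition of \<open>t \<succ> x\<close>. It shows that a
  surviving product in the \<open>\<beta>\<close> axiom is again an arrow occurring in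
  \<open>\<beta>\<close>.\<close>

lemma beta_arrow:
  assumes "t \<in> Q" "x \<in> F"
  shows "inv (sc t x) \<otimes> inv (t \<otimes> R t) \<otimes> Fp (t \<otimes> x) = inv (Qp (t \<otimes> x) \<otimes> R (Qp (t \<otimes> x)))"
proof -
  define s X s' where defs: "s = t \<otimes> R t" "X = Fp (t \<otimes> x)" "s' = Qp (t \<otimes> x) \<otimes> R (Qp (t \<otimes> x))"
  have cl: "s \<in> F" "X \<in> F" "s' \<in> F"
    using assms unfolding defs by simp_all
  have "sc t x = inv s \<otimes> X \<otimes> s'"
    unfolding succF_def actF_def actQ_def defs using assms by (simp add: thetaF_R)
  then show ?thesis
    using cl unfolding defs[symmetric] by (simp add: inv_mult_group m_assoc)
qed

text \<open>The group element reduces to \<open>inv x \<otimes> inv t\<close>, in the coset of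
  \<open>inv t\<close>. So the antipode of \<open>\<delta>\<^sub>t x\<close> times
  \<open>\<beta>\<close> ends at \<open>L t\<close>, and only terms with \<open>s = L t\<close>
  survive.\<close>

lemma Qp_R_inv:
  assumes "t \<in> Q" "x \<in> F"
  shows "Qp (R (Qp (t \<otimes> x)) \<otimes> (inv (sc t x) \<otimes> inv (t \<otimes> R t))) = L t"
proof -
  have "R (Qp (t \<otimes> x)) \<otimes> (inv (sc t x) \<otimes> inv (t \<otimes> R t)) = inv x \<otimes> R t \<otimes> inv (t \<otimes> R t)"
    using assms R_mult_inv_succF[OF assms] by (simp flip: m_assoc)
  also have "\<dots> = inv x \<otimes> inv t"
    using assms by (simp add: inv_mult_group m_assoc)
  finally show ?thesis
    using assms by (simp add: L_eq)
qed

lemma antipode_mult_beta_mult: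
  assumes "t \<in> Q" "x \<in> F" "b \<in> Q \<times> F"
  shows "antipode (bv (t, x)) \<otimes>\<^bsub>A\<^esub> (beta \<otimes>\<^bsub>A\<^esub> bv b)
    = scale (antipode_coeff t x * beta_coeff (R t) * \<omega> (R (Qp (t \<otimes> x))) (inv (sc t x)) (inv (t \<otimes> R t))
        * smash_coeff (R (Qp (t \<otimes> x)), inv (sc t x) \<otimes> inv (t \<otimes> R t)) b)
    (bv (smash_index (R (Qp (t \<otimes> x)), inv (sc t x) \<otimes> inv (t \<otimes> R t)) b))"
  using assms by (simp add: antipode_bv A.mult_scale_left bv_mult_beta_mult) (simp add: scale_def mult.assoc)

lemma antipode_beta:
  assumes "h \<in> vec_on (Q \<times> F)"
  shows "(\<Sum>(a, b)\<in>(Q \<times> F) \<times> (Q \<times> F). \<Delta> h (a, b) * (antipode (bv b) \<otimes>\<^bsub>A\<^esub> (beta \<otimes>\<^bsub>A\<^esub> bv a)) d)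
    = scale (smash_counit G F Q h) beta d"
proof -
  let ?B = "\<lambda>t. beta_coeff (R t) * bv (R t, inv (t \<otimes> R t)) d"
  have "(\<Sum>(a, b)\<in>(Q \<times> F) \<times> (Q \<times> F). \<Delta> h (a, b) * (antipode (bv b) \<otimes>\<^bsub>A\<^esub> (beta \<otimes>\<^bsub>A\<^esub> bv a)) d)
    = (\<Sum>(s, t, x)\<in>Q \<times> Q \<times> F. h (Qp (s \<otimes> t), x) * \<omega> s t x *
        (antipode (bv (t, x)) \<otimes>\<^bsub>A\<^esub> (beta \<otimes>\<^bsub>A\<^esub> bv (s, Fp (t \<otimes> x)))) d)"
    unfolding comult_eq[OF assms]
    by (subst sum2_lincomb) (auto intro!: sum.cong)
  also have "\<dots> = (\<Sum>(s, t, x)\<in>Q \<times> Q \<times> F. if s = L t then h (\<one>, x) * ?B (Qp (t \<otimes> x)) else 0)"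
  proof (rule sum.cong, simp, clarify)
    fix s t x assume cl: "s \<in> Q" "t \<in> Q" "x \<in> F"
    show "h (Qp (s \<otimes> t), x) * \<omega> s t x * (antipode (bv (t, x)) \<otimes>\<^bsub>A\<^esub> (beta \<otimes>\<^bsub>A\<^esub> bv (s, Fp (t \<otimes> x)))) d
      = (if s = L t then h (\<one>, x) * ?B (Qp (t \<otimes> x)) else 0)"
    proof (cases "s = L t")
      case True
      have "h (Qp (s \<otimes> t), x) * \<omega> s t x * (antipode (bv (t, x)) \<otimes>\<^bsub>A\<^esub> (beta \<otimes>\<^bsub>A\<^esub> bv (s, Fp (t \<otimes> x)))) d
        = h (\<one>, x) * ((\<omega> (L t) t x * antipode_coeff t x * beta_coeff (R t)
            * \<omega> (R (Qp (t \<otimes> x))) (inv (sc t x)) (inv (t \<otimes> R t))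
            * \<omega> (R (Qp (t \<otimes> x))) (inv (sc t x) \<otimes> inv (t \<otimes> R t)) (Fp (t \<otimes> x)))
            * bv (R (Qp (t \<otimes> x)), inv (sc t x) \<otimes> inv (t \<otimes> R t) \<otimes> Fp (t \<otimes> x)) d)"
        using cl True by (simp add: antipode_mult_beta_mult Qp_R_inv scale_def mult.assoc)
      also have "\<dots> = h (\<one>, x) * ?B (Qp (t \<otimes> x))"
        unfolding beta_coeff_def beta_arrow[OF cl(2,3)] omega_beta[OF cl(2,3)] by (rule refl)
      finally show ?thesis using True by simp
    next
      case False
      then show ?thesis
        using cl by (simp add: antipode_mult_beta_mult Qp_R_inv scale_def)
    qed
  qed
  also have "\<dots> = (\<Sum>t\<in>Q. \<Sum>s\<in>Q. if s = L t then (\<Sum>x\<in>F. h (\<one>, x) * ?B (Qp (t \<otimes> x))) else 0)"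
    unfolding sum.cartesian_product' by (subst sum.swap) (intro sum.cong refl, auto)
  also have "\<dots> = (\<Sum>t\<in>Q. \<Sum>x\<in>F. h (\<one>, x) * ?B (Qp (t \<otimes> x)))"
    by (rule sum.cong) auto
  also have "\<dots> = (\<Sum>x\<in>F. h (\<one>, x) * (\<Sum>t\<in>Q. ?B (Qp (t \<otimes> x))))"
    by (subst sum.swap) (simp add: sum_distrib_left)
  also have "\<dots> = (\<Sum>x\<in>F. h (\<one>, x) * beta d)"
  proof (rule sum.cong)
    fix x assume x: "x \<in> F"
    \<comment> \<open>Acting by \<open>x\<close> permutes \<open>Q\<close>, so the inner sum is
      independent of \<open>x\<close>; what remains of the outer sum is the counit of
      \<open>h\<close>.\<close>
    have "(\<Sum>t\<in>Q. ?B (Qp (t \<otimes> x))) = (\<Sum>t\<in>Q. ?B t)"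
      by (rule sum.reindex_bij_witness[where i = "\<lambda>t. Qp (t \<otimes> inv x)" and j = "\<lambda>t. Qp (t \<otimes> x)"])
        (use x in \<open>auto simp: m_assoc\<close>)
    also have "\<dots> = (\<Sum>t\<in>Q. beta_coeff (R t) * bv (R t, inv (L (R t) \<otimes> R t)) d)"
      by (rule sum.cong) auto
    also have "\<dots> = beta d"
      unfolding sum_R[of "\<lambda>q. beta_coeff q * bv (q, inv (L q \<otimes> q)) d"] by (simp add: beta_def lincomb_def)
    finally show "h (\<one>, x) * (\<Sum>t\<in>Q. ?B (Qp (t \<otimes> x))) = h (\<one>, x) * beta d" by simp
  qed simp
  finally show ?thesis
    by (simp add: counit_eq scale_def sum_distrib_right)
qed

text \<open>Composability forces \<open>p = L q\<close> and \<open>r = R q\<close>; by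
  \<open>omega_antipode_assoc\<close> each \<open>q\<close> then contributes the identity arrow at
  \<open>R q\<close> with coefficient 1.\<close>

lemma antipode_assoc:
  "(\<Sum>(a, b, c)\<in>(Q \<times> F) \<times> (Q \<times> F) \<times> (Q \<times> F). \<Phi> (a, b, c) *
      (bv c \<otimes>\<^bsub>A\<^esub> (\<one>\<^bsub>A\<^esub> \<otimes>\<^bsub>A\<^esub> (antipode (bv b) \<otimes>\<^bsub>A\<^esub> (beta \<otimes>\<^bsub>A\<^esub> bv a)))) d) = \<one>\<^bsub>A\<^esub> d"
proof -
  have "(\<Sum>(a, b, c)\<in>(Q \<times> F) \<times> (Q \<times> F) \<times> (Q \<times> F). \<Phi> (a, b, c) *
      (bv c \<otimes>\<^bsub>A\<^esub> (\<one>\<^bsub>A\<^esub> \<otimes>\<^bsub>A\<^esub> (antipode (bv b) \<otimes>\<^bsub>A\<^esub> (beta \<otimes>\<^bsub>A\<^esub> bv a)))) d)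
    = (\<Sum>(p, q, r)\<in>Q \<times> Q \<times> Q. \<omega> p q r *
      (bv (r, \<one>) \<otimes>\<^bsub>A\<^esub> (antipode (bv (q, \<one>)) \<otimes>\<^bsub>A\<^esub> (beta \<otimes>\<^bsub>A\<^esub> bv (p, Fp (q \<otimes> r))))) d)"
    unfolding associator_eq
    using A.mult_closed by (subst sum3_lincomb) (auto simp: A.one_mult intro!: sum.cong)
  also have "\<dots> = (\<Sum>(p, q, r)\<in>Q \<times> Q \<times> Q. if p = L q then if r = R q then bv (R q, \<one>) d else 0 else 0)"
  proof (rule sum.cong, simp, clarify)
    fix p q r assume cl: "p \<in> Q" "q \<in> Q" "r \<in> Q"
    have "bv (r, \<one>) \<otimes>\<^bsub>A\<^esub> (antipode (bv (q, \<one>)) \<otimes>\<^bsub>A\<^esub> (beta \<otimes>\<^bsub>A\<^esub> bv (p, Fp (q \<otimes> r))))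
      = scale (beta_coeff (R q) * (if L q = p then \<omega> (R q) (inv (q \<otimes> R q)) (Fp (q \<otimes> r)) else 0) * (if r = R q then 1 else 0))
         (bv (r, inv (q \<otimes> R q) \<otimes> Fp (q \<otimes> r)))"
      using cl Qp_R_inv[of q \<one>]
      by (simp add: antipode_mult_beta_mult A.mult_scale_right A.bv_mult) (auto simp: scale_def mult.assoc)
    then show "\<omega> p q r * (bv (r, \<one>) \<otimes>\<^bsub>A\<^esub> (antipode (bv (q, \<one>)) \<otimes>\<^bsub>A\<^esub> (beta \<otimes>\<^bsub>A\<^esub> bv (p, Fp (q \<otimes> r))))) d
      = (if p = L q then if r = R q then bv (R q, \<one>) d else 0 else 0)"
      using cl omega_antipode_assoc[of q] by (auto simp: scale_def beta_coeff_def mult.assoc)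
  qed
  also have "\<dots> = (\<Sum>q\<in>Q. \<Sum>p\<in>Q. if p = L q then (\<Sum>r\<in>Q. if r = R q then bv (R q, \<one>) d else 0) else 0)"
    unfolding sum.cartesian_product' by (subst sum.swap) (intro sum.cong refl, auto)
  also have "\<dots> = (\<Sum>q\<in>Q. bv (R q, \<one>) d)"
    by (rule sum.cong) auto
  also have "\<dots> = \<one>\<^bsub>A\<^esub> d"
    unfolding sum_R[of "\<lambda>q. bv (q, \<one>) d"] by (simp add: one_A lincomb_def)
  finally show ?thesis .
qed

text \<open>Composability forces \<open>q = R p\<close> and \<open>r = R q\<close>, so one identity
  arrow remains for each \<open>p\<close>, with scalar given by
  \<open>omega_antipode_assoc_inv\<close>.\<close>

lemma antipode_assoc_inv:
  "(\<Sum>(a, b, c)\<in>(Q \<times> F) \<times> (Q \<times> F) \<times> (Q \<times> F). associator_inv (a, b, c) *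
      (antipode (bv c) \<otimes>\<^bsub>A\<^esub> (beta \<otimes>\<^bsub>A\<^esub> (bv b \<otimes>\<^bsub>A\<^esub> (\<one>\<^bsub>A\<^esub> \<otimes>\<^bsub>A\<^esub> antipode (bv a))))) d) = \<one>\<^bsub>A\<^esub> d"
proof -
  have "(\<Sum>(a, b, c)\<in>(Q \<times> F) \<times> (Q \<times> F) \<times> (Q \<times> F). associator_inv (a, b, c) *
      (antipode (bv c) \<otimes>\<^bsub>A\<^esub> (beta \<otimes>\<^bsub>A\<^esub> (bv b \<otimes>\<^bsub>A\<^esub> (\<one>\<^bsub>A\<^esub> \<otimes>\<^bsub>A\<^esub> antipode (bv a))))) d)
    = (\<Sum>(p, q, r)\<in>Q \<times> Q \<times> Q. inverse (\<omega> p q r) * inverse (\<omega> p (Fp (q \<otimes> r)) (inv (Fp (q \<otimes> r)))) *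
      (antipode (bv (r, \<one>)) \<otimes>\<^bsub>A\<^esub> (beta \<otimes>\<^bsub>A\<^esub> (bv (q, \<one>) \<otimes>\<^bsub>A\<^esub> antipode (bv (Qp (p \<otimes> Fp (q \<otimes> r)), inv (Fp (q \<otimes> r))))))) d)"
    unfolding associator_inv_def
    by (subst sum3_lincomb) (auto simp: A.one_mult antipode_closed intro!: sum.cong)
  also have "\<dots> = (\<Sum>(p, q, r)\<in>Q \<times> Q \<times> Q. if q = R p then if r = R q then bv (R r, \<one>) d else 0 else 0)"
  proof (rule sum.cong, simp, clarify)
    fix p q r assume cl: "p \<in> Q" "q \<in> Q" "r \<in> Q"
    define f where "f = Fp (q \<otimes> r)"
    define p' where "p' = Qp (p \<otimes> f)"
    have f: "f \<in> F" and p': "p' \<in> Q" using cl by (simp_all add: f_def p'_def)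
    have p'f: "Qp (p' \<otimes> inv f) = p"
      using cl f by (simp add: p'_def m_assoc)
    have "bv (q, \<one>) \<otimes>\<^bsub>A\<^esub> antipode (bv (p', inv f))
      = scale (antipode_coeff p' (inv f) * (if q = R p then 1 else 0)) (bv (q, inv (sc p' (inv f))))"
      using cl f p' by (simp add: antipode_bv A.mult_scale_right A.bv_mult p'f) (auto simp: scale_def mult.assoc)
    then have *: "antipode (bv (r, \<one>)) \<otimes>\<^bsub>A\<^esub> (beta \<otimes>\<^bsub>A\<^esub> (bv (q, \<one>) \<otimes>\<^bsub>A\<^esub> antipode (bv (p', inv f))))
      = scale (antipode_coeff p' (inv f) * (if q = R p then 1 else 0) * beta_coeff (R r)
          * (if L r = q then \<omega> (R r) (inv (r \<otimes> R r)) (inv (sc p' (inv f))) else 0))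
         (bv (R r, inv (r \<otimes> R r) \<otimes> inv (sc p' (inv f))))"
      using cl f p' Qp_R_inv[of r \<one>]
      by (simp add: antipode_mult_beta_mult A.mult_scale_right) (auto simp: scale_def mult.assoc)
    show "inverse (\<omega> p q r) * inverse (\<omega> p (Fp (q \<otimes> r)) (inv (Fp (q \<otimes> r)))) *
      (antipode (bv (r, \<one>)) \<otimes>\<^bsub>A\<^esub> (beta \<otimes>\<^bsub>A\<^esub> (bv (q, \<one>) \<otimes>\<^bsub>A\<^esub> antipode (bv (Qp (p \<otimes> Fp (q \<otimes> r)), inv (Fp (q \<otimes> r))))))) d
      = (if q = R p then if r = R q then bv (R r, \<one>) d else 0 else 0)"
    proof (cases "q = R p \<and> r = R q")
      case True
      then have pq: "p = L q" "q = L r" using cl by auto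
      have f': "f = q \<otimes> r" using cl by (simp add: f_def pq)
      \<comment> \<open>Here \<open>p \<otimes> f = (p \<otimes> q) \<otimes> r\<close> with
        \<open>p \<otimes> q\<close> in \<open>F\<close>, so acting by \<open>f\<close> carries
        \<open>p\<close> to \<open>r\<close>.\<close>
      have r: "p' = r"
        using cl by (simp add: p'_def f' pq flip: m_assoc)
      have rf: "r \<otimes> inv f = inv q"
        using cl by (simp add: f' inv_mult_group)
      \<comment> \<open>The two arrows multiplied last are therefore mutually inverse in
        \<open>F\<close>, and the scalar of their product cancels the second factor of
        \<open>antipode_coeff\<close>.\<close>
      have s: "sc r (inv f) = inv (r \<otimes> R r)"
        using cl f by (simp add: succF_eq rf L_eq[symmetric]) (simp add: f' inv_mult_group m_assoc)
      have "\<omega> p q r * \<omega> p f (inv f) * \<omega> r (R r) (inv (r \<otimes> R r)) = beta_coeff (R r)"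
        using omega_antipode_assoc_inv[OF cl(3)] by (simp add: pq f' beta_coeff_def)
      then show ?thesis
        using cl f unfolding f_def[symmetric] p'_def[symmetric] *
        by (simp add: r s antipode_coeff_def scale_def pq field_simps)
    next
      case False
      then have "\<not> (q = R p \<and> L r = q)" using R_L[OF cl(3)] by auto
      then show ?thesis
        using False unfolding f_def[symmetric] p'_def[symmetric] * by (auto simp: scale_def)
    qed
  qed
  also have "\<dots> = (\<Sum>p\<in>Q. \<Sum>q\<in>Q. if q = R p then (\<Sum>r\<in>Q. if r = R q then bv (R r, \<one>) d else 0) else 0)"
    unfolding sum.cartesian_product' by (intro sum.cong refl) auto
  also have "\<dots> = (\<Sum>p\<in>Q. bv (R (R (R p)), \<one>) d)"
    by (rule sum.cong) auto
  also have "\<dots> = \<one>\<^bsub>A\<^esub> d"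
    unfolding sum_R[of "\<lambda>q. bv (R (R q), \<one>) d"] sum_R[of "\<lambda>q. bv (R q, \<one>) d"] sum_R[of "\<lambda>q. bv (q, \<one>) d"] by (simp add: one_A lincomb_def)
  finally show ?thesis .
qed

text \<open>Rewriting with \<open>tensor_alg_opposite\<close> turns every axiom into a statement
  about \<open>A\<close> with reversed products, in exactly the form proved above.\<close>

lemma quasi_hopf_opposite:
  "quasi_hopf_algebra (opposite_alg A) \<Delta> (smash_counit G F Q) \<Phi> antipode \<one>\<^bsub>opposite_alg A\<^esub> beta"
proof -
  have "based_algebra (opposite_alg A)"
    by (rule monomial_algebra.is_based_algebra[OF monomial_algebra_opposite[OF monomial_A]])
  then show ?thesis
    unfolding quasi_hopf_algebra_def quasi_hopf_algebra_axioms_def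
      quasi_bialgebra_def quasi_bialgebra_axioms_def
      tensor_alg_opposite opposite_alg_simps Units_opposite m_inv_opposite ixs_A A.carrier_eq m_inv_associator
    by (intro conjI allI impI comult_linear comult_mult comult_one counit_linear counit_one
        associator_Units pentagon counit_assoc counit_left counit_right quasi_coassoc
        antipode_linear antipode_bij antipode_mult antipode_one one_closed beta_closed
        antipode_alpha antipode_beta antipode_assoc antipode_assoc_inv ext)
      (auto simp: counit_mult mult.commute)
qed

end

theorem theorem4p12:
  fixes G :: "('g, 'm) monoid_scheme" (structure)
    and F Q :: "'g set"
    and \<omega> :: "'g \<Rightarrow> 'g \<Rightarrow> 'g \<Rightarrow> 'k::{alg_closed_field, field_char_0}"
  assumes "group G" and "finite (carrier G)"
    and "subgroup F G"
    and "two_sided_transversal G F Q"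
    and "normalized_3cocycle G \<omega>"
    and "\<forall>x\<in>F. \<forall>a\<in>carrier G. \<forall>b\<in>carrier G. \<omega> x a b = 1"
    and "\<forall>a\<in>carrier G. \<forall>x\<in>F. \<forall>q\<in>Q. \<omega> a x q = 1"
  shows "\<exists>S \<beta>.
    quasi_hopf_algebra (opposite_alg (smash_alg G F Q \<omega>))
      (smash_comult G F Q \<omega>) (smash_counit G F Q) (smash_associator G F Q \<omega>)
      S \<one>\<^bsub>opposite_alg (smash_alg G F Q \<omega>)\<^esub> \<beta> \<and>
    (\<forall>p\<in>Q. \<forall>x\<in>F. S (bv (p, x)) =
       scale (inverse (tau \<omega> (succF G F Q p x) p (rinvQ G F Q p))
              * inverse (sigma \<omega> (rinvQ G F Q p) (succF G F Q p x) (inv (succF G F Q p x))))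
         (bv (rinvQ G F Q (actQ G F Q p x), inv (succF G F Q p x)))) \<and>
    \<beta> = (\<lambda>d. \<Sum>q\<in>Q. \<omega> (inv q) q (inv q) * bv (q, inv (thetaF G F Q (linvQ G F Q q) q)) d) \<and>
    \<beta> = (\<lambda>d. \<Sum>q\<in>Q. inverse (\<omega> q (inv q) q) * bv (q, inv (thetaF G F Q (linvQ G F Q q) q)) d)"
proof -
  interpret group G by fact
  interpret transversal_cocycle G F Q \<omega>
    by (intro transversal_cocycle.intro group_transversal.intro group_transversal_axioms.intro
        transversal_cocycle_axioms.intro) fact+
  have "antipode (bv (p, x)) =
       scale (inverse (tau \<omega> (succF G F Q p x) p (rinvQ G F Q p))
              * inverse (sigma \<omega> (rinvQ G F Q p) (succF G F Q p x) (inv (succF G F Q p x))))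
         (bv (rinvQ G F Q (actQ G F Q p x), inv (succF G F Q p x)))" if "p \<in> Q" "x \<in> F" for p x
    using antipode_bv[OF that] by (simp add: antipode_coeff_def tau_def sigma_def actQ_def)
  moreover have beta: "beta = (\<lambda>d. \<Sum>q\<in>Q. \<omega> (inv q) q (inv q) * bv (q, inv (thetaF G F Q (linvQ G F Q q) q)) d)"
    by (simp add: beta_def lincomb_def beta_coeff_def thetaF_def)
  moreover have "beta = (\<lambda>d. \<Sum>q\<in>Q. inverse (\<omega> q (inv q) q) * bv (q, inv (thetaF G F Q (linvQ G F Q q) q)) d)"
    unfolding beta by (intro ext sum.cong) (simp_all add: omega_inverse)
  ultimately show ?thesis
    using quasi_hopf_opposite by blast
qed

end
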